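(* Let $(R,\delta)$ be a differential algebra with $R$ commutative. The ring $R[\delta]$ is weakly fadelian if and only if $R$ is a field and every nonzero element of $R[\delta]$ is surjective as an endomorphism of $R$.
   Context: All rings are nontrivial ($1\neq 0$), unital, associative, and not assumed commutative unless stated. A ring $A$ is weakly fadelian if for every nonzero $a\in A$ there exist $b,c\in A$ with $1=ab+ca$. Let $k$ be a commutative field and $R$ a central $k$-algebra (a unital $k$-algebra in which the image of $k$ lies in the centre of $R$). A derivation of $R$ is a nonzero $k$-linear map $\delta:R\to R$ such that $\delta(ab)=\delta(a)b+a\delta(b)$ for all $a,b\in R$; one then says that $(R,\delta)$ is a differential algebra. For $x\in R$, let $\tilde x:R\to R$, $y\mapsto xy$, be left multiplication by $x$. Then $R[\delta]$ denotes the $k$-subalgebra of $\mathrm{End}_k(R)$ (with composition as multiplication) generated by $\delta$ and all $\tilde x$, $x\in R$. *)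

theory Defs
  imports "HOL-Algebra.Module" "HOL-Algebra.Subrings" "HOL-Library.FuncSet"
begin

locale weakly_fadelian = ring A for A (structure) +
  assumes one_not_zero: "\<one> \<noteq> \<zero>"
    and weakly_fadelian:
      "\<lbrakk> a \<in> carrier A; a \<noteq> \<zero> \<rbrakk> \<Longrightarrow>
        \<exists>b \<in> carrier A. \<exists>c \<in> carrier A. \<one> = (a \<otimes> b) \<oplus> (c \<otimes> a)"

text \<open>The library locale \<^locale>\<open>algebra\<close> requires the algebra itself to be commutative; here
  only the scalars are.  The two compatibility laws say that scalars act
  centrally.\<close>

locale central_algebra = K?: field K + A?: ring A + module K A
  for K :: "('k, 'u) ring_scheme" (structure)
    and A :: "('k, 'a, 'v) module_scheme" (structure) +
  assumes nontrivial: "\<one>\<^bsub>A\<^esub> \<noteq> \<zero>\<^bsub>A\<^esub>"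
    and smult_mult_left:
      "\<lbrakk> c \<in> carrier K; x \<in> carrier A; y \<in> carrier A \<rbrakk> \<Longrightarrow>
        (c \<odot>\<^bsub>A\<^esub> x) \<otimes>\<^bsub>A\<^esub> y = c \<odot>\<^bsub>A\<^esub> (x \<otimes>\<^bsub>A\<^esub> y)"
    and smult_mult_right:
      "\<lbrakk> c \<in> carrier K; x \<in> carrier A; y \<in> carrier A \<rbrakk> \<Longrightarrow>
        x \<otimes>\<^bsub>A\<^esub> (c \<odot>\<^bsub>A\<^esub> y) = c \<odot>\<^bsub>A\<^esub> (x \<otimes>\<^bsub>A\<^esub> y)"

text \<open>Endomorphisms are represented by functions that are \<open>undefined\<close> outside the carrier, so
  that equality of functions is equality of endomorphisms.\<close>

definition linear_endos ::
    "('k, 'u) ring_scheme \<Rightarrow> ('k, 'a, 'v) module_scheme \<Rightarrow> ('a \<Rightarrow> 'a) set" where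
  "linear_endos K M =
    {f \<in> carrier M \<rightarrow>\<^sub>E carrier M.
      (\<forall>x \<in> carrier M. \<forall>y \<in> carrier M. f (x \<oplus>\<^bsub>M\<^esub> y) = f x \<oplus>\<^bsub>M\<^esub> f y) \<and>
      (\<forall>c \<in> carrier K. \<forall>x \<in> carrier M. f (c \<odot>\<^bsub>M\<^esub> x) = c \<odot>\<^bsub>M\<^esub> f x)}"

definition End_algebra ::
    "('k, 'u) ring_scheme \<Rightarrow> ('k, 'a, 'v) module_scheme \<Rightarrow> ('k, 'a \<Rightarrow> 'a) module" where
  "End_algebra K M =
    \<lparr>carrier = linear_endos K M,
     mult = compose (carrier M),
     one = (\<lambda>x \<in> carrier M. x),
     zero = (\<lambda>x \<in> carrier M. \<zero>\<^bsub>M\<^esub>),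
     add = (\<lambda>f g. \<lambda>x \<in> carrier M. f x \<oplus>\<^bsub>M\<^esub> g x),
     smult = (\<lambda>c f. \<lambda>x \<in> carrier M. c \<odot>\<^bsub>M\<^esub> f x)\<rparr>"

definition generated_subalgebra ::
    "('k, 'u) ring_scheme \<Rightarrow> ('k, 'a, 'v) module_scheme \<Rightarrow> 'a set \<Rightarrow> 'a set" where
  "generated_subalgebra K A H = \<Inter>{S. subring S A \<and> submodule S K A \<and> H \<subseteq> S}"

locale differential_algebra = central_algebra K R
  for K :: "('k, 'u) ring_scheme" (structure)
    and R :: "('k, 'a, 'v) module_scheme" (structure) +
  fixes \<delta> :: "'a \<Rightarrow> 'a"
  assumes derivation_linear: "\<delta> \<in> carrier (End_algebra K R)"
    and derivation_nonzero: "\<delta> \<noteq> \<zero>\<^bsub>End_algebra K R\<^esub>"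
    and leibniz:
      "\<lbrakk> a \<in> carrier R; b \<in> carrier R \<rbrakk> \<Longrightarrow>
        \<delta> (a \<otimes>\<^bsub>R\<^esub> b) = (\<delta> a \<otimes>\<^bsub>R\<^esub> b) \<oplus>\<^bsub>R\<^esub> (a \<otimes>\<^bsub>R\<^esub> \<delta> b)"

definition left_mult :: "('a, 'v) ring_scheme \<Rightarrow> 'a \<Rightarrow> 'a \<Rightarrow> 'a" where
  "left_mult R x = (\<lambda>y \<in> carrier R. x \<otimes>\<^bsub>R\<^esub> y)"

definition differential_operators ::
    "('k, 'u) ring_scheme \<Rightarrow> ('k, 'a, 'v) module_scheme \<Rightarrow> ('a \<Rightarrow> 'a) \<Rightarrow> ('k, 'a \<Rightarrow> 'a) module"
  where
  "differential_operators K R \<delta> =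
    (End_algebra K R)\<lparr>carrier :=
      generated_subalgebra K (End_algebra K R) (insert \<delta> (left_mult R ` carrier R))\<rparr>"

end

theory Submission
  imports Defs
begin

text \<open>
  Necessity. A weakly fadelian ring \<open>A\<close> has no zero divisors: in \<open>1 = a b + c a\<close> with \<open>a \<noteq> 0\<close>
  idempotent, multiplying by \<open>1 - a\<close> on both sides gives \<open>1 - a = 0\<close>; an \<open>a \<noteq> 0\<close> of square zero would
  make \<open>a b\<close> idempotent and equal to neither \<open>0\<close> nor \<open>1\<close>; and a ring without nilpotents in which
  \<open>x y = 0\<close> satisfies \<open>y w x = 0\<close> for all \<open>w\<close>. In \<open>R[\<delta>]\<close> the defining relation is then applied to
  \<open>f \<delta>\<close> instead of \<open>f\<close>. Evaluating \<open>1 = (f \<delta>) b + c (f \<delta>)\<close> at the element \<open>1\<close> of \<open>R\<close> kills the second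
  summand, because \<open>\<delta> 1 = 0\<close>, and leaves \<open>1 = f (\<delta> (b 1))\<close>. If \<open>f\<close> is multiplication by \<open>x \<noteq> 0\<close>, this
  inverts \<open>x\<close>, so that \<open>R\<close> is a field; for general \<open>f\<close> and \<open>r \<noteq> 0\<close>, the same fact for \<open>r\<^sup>-\<^sup>1 f\<close> shows that
  \<open>r\<close> is a value of \<open>f\<close>.

  Sufficiency. Write \<open>D\<close> for \<open>R[\<delta>]\<close>, where \<open>R\<close> is a field on which all nonzero elements of \<open>D\<close> are
  surjective. The elements of \<open>D\<close> are the sums of the \<open>r\<^sub>i \<delta>\<^sup>i\<close>, and the surjectivity of \<open>\<delta>\<close> makes the
  leading coefficient well defined (\<open>leading_coefficient_zero\<close>), in every characteristic. Division with
  remainder shows that left ideals of \<open>D\<close> are principal (\<open>left_ideal_principal\<close>). The hypothesis says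
  that the left \<open>D\<close>-module \<open>R\<close> is divisible; over a principal left ideal domain this gives Baer's
  criterion for injectivity, and \<open>functional_extension\<close> is the instance for submodules of free modules
  of finite rank. Hence every square system of linear equations over \<open>D\<close> whose matrix is
  \<open>\<delta>\<^sup>n\<close> times the identity plus terms of order below \<open>n\<close> is solvable in \<open>R\<close>
  (\<open>monic_system_solvable\<close>): its rows are independent over \<open>D\<close>, so they may be sent to
  any prescribed right-hand side.

  Now let \<open>a\<close> be monic of order \<open>n\<close>. The left module \<open>D/Da\<close> has the \<open>R\<close>-basis
  \<open>1, \<delta>, \<dots>, \<delta>\<^sup>n\<^sup>-\<^sup>1\<close>, and left multiplication by \<open>\<delta>\<close> acts on coordinates as the entrywise derivation plus
  a matrix over \<open>R\<close>. So left multiplication by \<open>a\<close> acts on coordinates through a matrix of operators of the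
  kind just described, and \<open>a b \<equiv> v\<close> modulo \<open>Da\<close> has a solution \<open>b\<close> for every \<open>v \<in> R\<close>
  (\<open>monic_left_congruence_solvable\<close>). A general nonzero operator is \<open>r a\<close> with \<open>r \<in> R\<close> nonzero and \<open>a\<close> monic;
  solving \<open>a b = r\<^sup>-\<^sup>1 + c a\<close> and multiplying by \<open>r\<close> yields \<open>(r a) b = 1 + (r c r\<^sup>-\<^sup>1) (r a)\<close>, which is the
  required decomposition of \<open>1\<close>.
\<close>

section \<open>Weakly fadelian rings have no zero divisors\<close>

context weakly_fadelian
begin

text \<open>For \<open>f = 1 - e\<close> both \<open>f e\<close> and \<open>e f\<close> vanish, so that \<open>f = f (e b + c e) f = 0\<close>.\<close>
lemma idempotent_zero_or_one:
  assumes e: "e \<in> carrier A" "e \<otimes> e = e"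
  shows "e = \<zero> \<or> e = \<one>"
proof (rule disjCI)
  let ?f = "\<one> \<ominus> e"
  assume "e \<noteq> \<one>"
  have f: "?f \<in> carrier A" using e by simp
  show "e = \<zero>"
  proof (rule ccontr)
    assume "e \<noteq> \<zero>"
    then obtain b c where bc: "b \<in> carrier A" "c \<in> carrier A" "\<one> = e \<otimes> b \<oplus> c \<otimes> e"
      using weakly_fadelian e by blast
    have fe: "?f \<otimes> e = \<zero>" "e \<otimes> ?f = \<zero>" "?f \<otimes> ?f = ?f"
      using e by (simp_all add: minus_eq l_distr r_distr l_minus r_minus r_neg)
    have "?f = ?f \<otimes> (e \<otimes> b \<oplus> c \<otimes> e) \<otimes> ?f" using f fe(3) by (simp flip: bc(3))
    also have "\<dots> = (?f \<otimes> e) \<otimes> b \<otimes> ?f \<oplus> ?f \<otimes> c \<otimes> (e \<otimes> ?f)"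
      using f e bc(1,2) by (simp add: l_distr r_distr m_assoc)
    also have "\<dots> = \<zero>" using f e bc(1,2) by (simp add: fe)
    finally have "e = \<one>" using e
      by (metis minus_eq minus_equality minus_minus one_closed a_inv_closed)
    with \<open>e \<noteq> \<one>\<close> show False by contradiction
  qed
qed

text \<open>Multiplying \<open>1 = a b + c a\<close> by \<open>a\<close> on the right gives \<open>a = a b a\<close>. Thus \<open>a b\<close> is idempotent, and
  neither \<open>a b = 0\<close> nor \<open>a b = 1\<close> is compatible with \<open>a \<noteq> 0\<close> and \<open>a\<^sup>2 = 0\<close>.\<close>
lemma no_square_zero:
  assumes a: "a \<in> carrier A" "a \<otimes> a = \<zero>"
  shows "a = \<zero>"
proof (rule ccontr)
  assume "a \<noteq> \<zero>"
  then obtain b c where bc: "b \<in> carrier A" "c \<in> carrier A" "\<one> = a \<otimes> b \<oplus> c \<otimes> a"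
    using weakly_fadelian a by blast
  have "a = (a \<otimes> b \<oplus> c \<otimes> a) \<otimes> a" using a by (simp flip: bc(3))
  also have "\<dots> = a \<otimes> b \<otimes> a" using a bc(1,2) by (simp add: l_distr m_assoc)
  finally have aba: "a = a \<otimes> b \<otimes> a" .
  then have "(a \<otimes> b) \<otimes> (a \<otimes> b) = a \<otimes> b" using a bc(1,2) by (metis m_assoc m_closed)
  then have "a \<otimes> b = \<zero> \<or> a \<otimes> b = \<one>" using a bc(1) by (intro idempotent_zero_or_one) auto
  then show False
  proof
    assume "a \<otimes> b = \<zero>"
    then show False using aba a \<open>a \<noteq> \<zero>\<close> by simp
  next
    assume "a \<otimes> b = \<one>"
    then have "a = a \<otimes> (a \<otimes> b)" using a by simp
    also have "\<dots> = \<zero>" using a bc(1) by (simp add: m_assoc[symmetric])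
    finally show False using \<open>a \<noteq> \<zero>\<close> by contradiction
  qed
qed

text \<open>If \<open>x y = 0\<close>, then all \<open>y w x\<close> have square zero and therefore vanish. Writing
  \<open>1 = y b + c y\<close> then turns \<open>x\<close> into \<open>y b x + c y x = 0\<close>.\<close>
lemma no_zero_divisors:
  assumes x: "x \<in> carrier A" and y: "y \<in> carrier A" and xy: "x \<otimes> y = \<zero>"
  shows "x = \<zero> \<or> y = \<zero>"
proof (rule disjCI)
  assume "y \<noteq> \<zero>"
  have ywx: "y \<otimes> w \<otimes> x = \<zero>" if w: "w \<in> carrier A" for w
  proof (rule no_square_zero)
    have "(y \<otimes> w \<otimes> x) \<otimes> (y \<otimes> w \<otimes> x) = y \<otimes> w \<otimes> (x \<otimes> y) \<otimes> (w \<otimes> x)"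
      using x y w by (simp add: m_assoc)
    also have "\<dots> = \<zero>" using x y w by (simp add: xy)
    finally show "(y \<otimes> w \<otimes> x) \<otimes> (y \<otimes> w \<otimes> x) = \<zero>" .
  qed (use x y w in simp)
  obtain b c where bc: "b \<in> carrier A" "c \<in> carrier A" "\<one> = y \<otimes> b \<oplus> c \<otimes> y"
    using weakly_fadelian y \<open>y \<noteq> \<zero>\<close> by blast
  have "x = (y \<otimes> b \<oplus> c \<otimes> y) \<otimes> x" using x by (simp flip: bc(3))
  also have "\<dots> = c \<otimes> (y \<otimes> x)"
    using x y bc(1,2) ywx[OF bc(1)] by (simp add: l_distr m_assoc)
  also have "y \<otimes> x = \<zero>" using ywx[of \<one>] x y by simp
  finally show "x = \<zero>" using bc(2) by simp
qed

end

section \<open>Differential operators filtered by order\<close>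

text \<open>A ring of additive operators on a commutative ring \<open>R\<close> that contains a derivation and all
  multiplications. Operators are compared only on the carrier (\<open>op_eqI\<close>), so the computations below
  do not depend on how functions are encoded outside it. A scalar \<open>c\<close> acts as multiplication by \<open>c 1\<close>, so the
  subalgebra generated by the derivation and the multiplications is already generated as a ring.\<close>
locale operator_ring = E?: ring E + R: cring R
  for E :: "('r \<Rightarrow> 'r, 'e) ring_scheme" (structure)
    and R :: "('r, 's) ring_scheme" +
  fixes \<delta> :: "'r \<Rightarrow> 'r"
  assumes delta_in: "\<delta> \<in> carrier E"
    and left_mult_in: "r \<in> carrier R \<Longrightarrow> left_mult R r \<in> carrier E"
    and op_closed: "\<lbrakk> f \<in> carrier E; x \<in> carrier R \<rbrakk> \<Longrightarrow> f x \<in> carrier R"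
    and op_add: "\<lbrakk> f \<in> carrier E; x \<in> carrier R; y \<in> carrier R \<rbrakk> \<Longrightarrow>
        f (x \<oplus>\<^bsub>R\<^esub> y) = f x \<oplus>\<^bsub>R\<^esub> f y"
    and op_eqI: "\<lbrakk> f \<in> carrier E; g \<in> carrier E; \<And>x. x \<in> carrier R \<Longrightarrow> f x = g x \<rbrakk> \<Longrightarrow> f = g"
    and add_apply: "\<lbrakk> f \<in> carrier E; g \<in> carrier E; x \<in> carrier R \<rbrakk> \<Longrightarrow>
        (f \<oplus> g) x = f x \<oplus>\<^bsub>R\<^esub> g x"
    and mult_apply: "\<lbrakk> f \<in> carrier E; g \<in> carrier E; x \<in> carrier R \<rbrakk> \<Longrightarrow> (f \<otimes> g) x = f (g x)"
    and one_apply: "x \<in> carrier R \<Longrightarrow> \<one> x = x"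
    and zero_apply: "x \<in> carrier R \<Longrightarrow> \<zero> x = \<zero>\<^bsub>R\<^esub>"
    and leibniz: "\<lbrakk> x \<in> carrier R; y \<in> carrier R \<rbrakk> \<Longrightarrow>
        \<delta> (x \<otimes>\<^bsub>R\<^esub> y) = (\<delta> x \<otimes>\<^bsub>R\<^esub> y) \<oplus>\<^bsub>R\<^esub> (x \<otimes>\<^bsub>R\<^esub> \<delta> y)"
begin

abbreviation \<iota> :: "'r \<Rightarrow> 'r \<Rightarrow> 'r" where "\<iota> \<equiv> left_mult R"

lemmas closed = delta_in left_mult_in op_closed

lemma left_mult_apply: "x \<in> carrier R \<Longrightarrow> \<iota> r x = r \<otimes>\<^bsub>R\<^esub> x"
  by (simp add: left_mult_def)

lemmas applies = add_apply mult_apply one_apply zero_apply left_mult_apply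

lemma op_zero: "f \<in> carrier E \<Longrightarrow> f \<zero>\<^bsub>R\<^esub> = \<zero>\<^bsub>R\<^esub>"
  by (metis R.add.r_cancel_one R.add.one_closed R.l_zero op_add op_closed)

lemma minus_apply:
  assumes "f \<in> carrier E" "x \<in> carrier R"
  shows "(\<ominus> f) x = \<ominus>\<^bsub>R\<^esub> f x"
proof -
  have "(\<ominus> f) x \<oplus>\<^bsub>R\<^esub> f x = (\<ominus> f \<oplus> f) x"
    using assms by (simp add: add_apply)
  also have "\<dots> = \<zero>\<^bsub>R\<^esub>" using assms by (simp add: E.l_neg zero_apply)
  finally show ?thesis using assms by (simp add: R.minus_equality op_closed)
qed

lemma diff_apply:
  "\<lbrakk> f \<in> carrier E; g \<in> carrier E; x \<in> carrier R \<rbrakk> \<Longrightarrow> (f \<ominus> g) x = f x \<ominus>\<^bsub>R\<^esub> g x"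
  by (simp add: E.minus_eq R.minus_eq add_apply minus_apply)

lemma op_minus:
  assumes "f \<in> carrier E" "x \<in> carrier R"
  shows "f (\<ominus>\<^bsub>R\<^esub> x) = \<ominus>\<^bsub>R\<^esub> f x"
proof -
  have "f (\<ominus>\<^bsub>R\<^esub> x) \<oplus>\<^bsub>R\<^esub> f x = f (\<ominus>\<^bsub>R\<^esub> x \<oplus>\<^bsub>R\<^esub> x)"
    using assms by (simp add: op_add)
  also have "\<dots> = \<zero>\<^bsub>R\<^esub>" using assms by (simp add: R.l_neg op_zero)
  finally show ?thesis using assms by (simp add: R.minus_equality op_closed)
qed

lemma op_diff:
  "\<lbrakk> f \<in> carrier E; x \<in> carrier R; y \<in> carrier R \<rbrakk> \<Longrightarrow>
    f (x \<ominus>\<^bsub>R\<^esub> y) = f x \<ominus>\<^bsub>R\<^esub> f y"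
  by (simp add: R.minus_eq op_add op_minus)

lemma left_mult_one: "\<iota> \<one>\<^bsub>R\<^esub> = \<one>"
  by (rule op_eqI) (simp_all add: left_mult_in applies)

lemma left_mult_zero: "\<iota> \<zero>\<^bsub>R\<^esub> = \<zero>"
  by (rule op_eqI) (simp_all add: left_mult_in applies)

lemma left_mult_add:
  "\<lbrakk> r \<in> carrier R; s \<in> carrier R \<rbrakk> \<Longrightarrow> \<iota> (r \<oplus>\<^bsub>R\<^esub> s) = \<iota> r \<oplus> \<iota> s"
  by (rule op_eqI) (simp_all add: left_mult_in applies R.l_distr)

lemma left_mult_minus:
  "r \<in> carrier R \<Longrightarrow> \<iota> (\<ominus>\<^bsub>R\<^esub> r) = \<ominus> \<iota> r"
  by (rule op_eqI) (simp_all add: left_mult_in applies minus_apply R.l_minus)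

lemma left_mult_mult:
  "\<lbrakk> r \<in> carrier R; s \<in> carrier R \<rbrakk> \<Longrightarrow> \<iota> (r \<otimes>\<^bsub>R\<^esub> s) = \<iota> r \<otimes> \<iota> s"
  by (rule op_eqI) (simp_all add: left_mult_in applies R.m_assoc)

lemma delta_left_mult:
  "r \<in> carrier R \<Longrightarrow> \<delta> \<otimes> \<iota> r = \<iota> (\<delta> r) \<oplus> \<iota> r \<otimes> \<delta>"
  by (rule op_eqI) (simp_all add: closed applies leibniz)

lemma delta_one: "\<delta> \<one>\<^bsub>R\<^esub> = \<zero>\<^bsub>R\<^esub>"
proof -
  have "\<delta> \<one>\<^bsub>R\<^esub> = \<delta> \<one>\<^bsub>R\<^esub> \<oplus>\<^bsub>R\<^esub> \<delta> \<one>\<^bsub>R\<^esub>"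
    using leibniz[of "\<one>\<^bsub>R\<^esub>" "\<one>\<^bsub>R\<^esub>"] by (simp add: closed)
  then show ?thesis by (simp add: closed)
qed

text \<open>The operators of order less than \<open>n\<close>, written with coefficients on the left. The strict
  bound lets \<open>{0}\<close> be the bottom of the filtration.\<close>
primrec ord_lt :: "nat \<Rightarrow> ('r \<Rightarrow> 'r) set" where
  "ord_lt 0 = {\<zero>}"
| "ord_lt (Suc n) = {f \<oplus> \<iota> r \<otimes> \<delta> [^] n | f r. f \<in> ord_lt n \<and> r \<in> carrier R}"

definition operators :: "('r \<Rightarrow> 'r) set" where
  "operators = (\<Union>n. ord_lt n)"

lemma ord_lt_SucI:
  "\<lbrakk> f \<in> ord_lt n; r \<in> carrier R \<rbrakk> \<Longrightarrow> f \<oplus> \<iota> r \<otimes> \<delta> [^] n \<in> ord_lt (Suc n)"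
  by auto

lemma ord_lt_SucE:
  assumes "g \<in> ord_lt (Suc n)"
  obtains f r where "f \<in> ord_lt n" "r \<in> carrier R" "g = f \<oplus> \<iota> r \<otimes> \<delta> [^] n"
  using assms by auto

lemma ord_lt_closed: "f \<in> ord_lt n \<Longrightarrow> f \<in> carrier E"
  by (induction n arbitrary: f) (auto simp: closed)

lemma ord_lt_Suc: "f \<in> ord_lt n \<Longrightarrow> f \<in> ord_lt (Suc n)"
  using ord_lt_SucI[of f n "\<zero>\<^bsub>R\<^esub>"] by (simp add: left_mult_zero ord_lt_closed closed)

lemma ord_lt_mono: "m \<le> n \<Longrightarrow> f \<in> ord_lt m \<Longrightarrow> f \<in> ord_lt n"
  by (induction rule: dec_induct) (auto intro: ord_lt_Suc simp del: ord_lt.simps)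

lemma ord_lt_zero: "\<zero> \<in> ord_lt n"
  using ord_lt_mono[of 0 n] by simp

lemma ord_lt_add: "\<lbrakk> f \<in> ord_lt n; g \<in> ord_lt n \<rbrakk> \<Longrightarrow> f \<oplus> g \<in> ord_lt n"
proof (induction n arbitrary: f g)
  case (Suc n)
  obtain f' r where f: "f' \<in> ord_lt n" "r \<in> carrier R" "f = f' \<oplus> \<iota> r \<otimes> \<delta> [^] n"
    using Suc.prems(1) by (rule ord_lt_SucE)
  obtain g' s where g: "g' \<in> ord_lt n" "s \<in> carrier R" "g = g' \<oplus> \<iota> s \<otimes> \<delta> [^] n"
    using Suc.prems(2) by (rule ord_lt_SucE)
  have "f \<oplus> g = (f' \<oplus> g') \<oplus> \<iota> (r \<oplus>\<^bsub>R\<^esub> s) \<otimes> \<delta> [^] n"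
    using f g by (simp add: left_mult_add ord_lt_closed closed E.l_distr E.a_ac)
  then show ?case using Suc.IH[of f' g'] f g by (auto intro!: ord_lt_SucI simp del: ord_lt.simps)
qed simp

lemma ord_lt_left_mult: "\<lbrakk> r \<in> carrier R; f \<in> ord_lt n \<rbrakk> \<Longrightarrow> \<iota> r \<otimes> f \<in> ord_lt n"
proof (induction n arbitrary: f)
  case (Suc n)
  obtain f' s where f: "f' \<in> ord_lt n" "s \<in> carrier R" "f = f' \<oplus> \<iota> s \<otimes> \<delta> [^] n"
    using Suc.prems(2) by (rule ord_lt_SucE)
  have "\<iota> r \<otimes> f = \<iota> r \<otimes> f' \<oplus> \<iota> (r \<otimes>\<^bsub>R\<^esub> s) \<otimes> \<delta> [^] n"
    using f Suc.prems by (simp add: left_mult_mult ord_lt_closed closed E.r_distr E.m_assoc)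
  then show ?case using Suc.IH[of f'] f Suc.prems
    by (auto intro!: ord_lt_SucI simp del: ord_lt.simps)
qed (simp add: closed)

lemma ord_lt_minus: "f \<in> ord_lt n \<Longrightarrow> \<ominus> f \<in> ord_lt n"
  using ord_lt_left_mult[of "\<ominus>\<^bsub>R\<^esub> \<one>\<^bsub>R\<^esub>" f n]
  by (simp add: left_mult_minus left_mult_one ord_lt_closed E.l_minus)

lemma ord_lt_diff: "\<lbrakk> f \<in> ord_lt n; g \<in> ord_lt n \<rbrakk> \<Longrightarrow> f \<ominus> g \<in> ord_lt n"
  by (simp add: E.minus_eq ord_lt_add ord_lt_minus)

lemma monomial_ord_lt: "r \<in> carrier R \<Longrightarrow> \<iota> r \<otimes> \<delta> [^] n \<in> ord_lt (Suc n)"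
  using ord_lt_SucI[OF ord_lt_zero, of r n] by (simp add: closed)

lemma left_mult_ord_lt: "r \<in> carrier R \<Longrightarrow> \<iota> r \<in> ord_lt (Suc 0)"
  using monomial_ord_lt[of r 0] by (simp add: closed)

lemma pow_ord_lt: "\<delta> [^] n \<in> ord_lt (Suc n)"
  using monomial_ord_lt[of "\<one>\<^bsub>R\<^esub>" n] by (simp add: left_mult_one closed)

lemma ord_lt_mult_delta: "f \<in> ord_lt n \<Longrightarrow> f \<otimes> \<delta> \<in> ord_lt (Suc n)"
proof (induction n arbitrary: f)
  case 0
  then show ?case using ord_lt_zero[of "Suc 0"] by (simp add: closed)
next
  case (Suc n)
  obtain f' s where f: "f' \<in> ord_lt n" "s \<in> carrier R" "f = f' \<oplus> \<iota> s \<otimes> \<delta> [^] n"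
    using Suc.prems by (rule ord_lt_SucE)
  have "f \<otimes> \<delta> = f' \<otimes> \<delta> \<oplus> \<iota> s \<otimes> \<delta> [^] Suc n"
    using f by (simp add: ord_lt_closed closed E.l_distr E.m_assoc)
  then show ?case by (metis Suc.IH f(1,2) ord_lt_SucI)
qed

lemma ord_lt_mult_delta_pow: "f \<in> ord_lt n \<Longrightarrow> f \<otimes> \<delta> [^] k \<in> ord_lt (n + k)"
proof (induction k)
  case 0
  then show ?case by (simp add: ord_lt_closed)
next
  case (Suc k)
  have "f \<otimes> \<delta> [^] Suc k = (f \<otimes> \<delta> [^] k) \<otimes> \<delta>"
    using Suc.prems by (simp add: ord_lt_closed closed E.m_assoc)
  then show ?case using ord_lt_mult_delta[OF Suc.IH[OF Suc.prems]] by simp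
qed

text \<open>The Leibniz rule in the form \<open>\<delta> r = \<delta>(r) + r \<delta>\<close> moves the coefficients back to the left.\<close>
lemma delta_mult_ord_lt: "f \<in> ord_lt n \<Longrightarrow> \<delta> \<otimes> f \<in> ord_lt (Suc n)"
proof (induction n arbitrary: f)
  case 0
  then show ?case using ord_lt_zero[of "Suc 0"] by (simp add: closed)
next
  case (Suc n)
  obtain f' s where f: "f' \<in> ord_lt n" "s \<in> carrier R" "f = f' \<oplus> \<iota> s \<otimes> \<delta> [^] n"
    using Suc.prems by (rule ord_lt_SucE)
  have "\<delta> \<otimes> f = (\<delta> \<otimes> f' \<oplus> \<iota> (\<delta> s) \<otimes> \<delta> [^] n) \<oplus> \<iota> s \<otimes> \<delta> [^] Suc n"
    using f by (simp add: ord_lt_closed closed E.r_distr E.l_distr E.m_assoc[symmetric]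
        delta_left_mult E.a_assoc del: E.nat_pow_Suc)
      (simp add: closed E.m_assoc E.nat_pow_Suc2[symmetric] del: E.nat_pow_Suc)
  moreover have "\<delta> \<otimes> f' \<oplus> \<iota> (\<delta> s) \<otimes> \<delta> [^] n \<in> ord_lt (Suc n)"
    using f by (intro ord_lt_add Suc.IH monomial_ord_lt) (simp_all add: closed)
  ultimately show ?case by (metis f(2) ord_lt_SucI)
qed

lemma delta_pow_mult_ord_lt: "f \<in> ord_lt n \<Longrightarrow> \<delta> [^] k \<otimes> f \<in> ord_lt (n + k)"
proof (induction k)
  case 0
  then show ?case by (simp add: ord_lt_closed)
next
  case (Suc k)
  have "\<delta> [^] Suc k \<otimes> f = \<delta> \<otimes> (\<delta> [^] k \<otimes> f)"
    unfolding E.nat_pow_Suc2[OF delta_in] using Suc.prems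
    by (simp add: ord_lt_closed closed E.m_assoc)
  then show ?case using delta_mult_ord_lt[OF Suc.IH[OF Suc.prems]] by simp
qed

lemma ord_lt_mult_left_mult: "\<lbrakk> f \<in> ord_lt n; r \<in> carrier R \<rbrakk> \<Longrightarrow> f \<otimes> \<iota> r \<in> ord_lt n"
proof (induction n arbitrary: f)
  case 0
  then show ?case using ord_lt_zero[of "0"] by (simp add: closed)
next
  case (Suc n)
  obtain f' s where f: "f' \<in> ord_lt n" "s \<in> carrier R" "f = f' \<oplus> \<iota> s \<otimes> \<delta> [^] n"
    using Suc.prems(1) by (rule ord_lt_SucE)
  have "f \<otimes> \<iota> r = f' \<otimes> \<iota> r \<oplus> \<iota> s \<otimes> (\<delta> [^] n \<otimes> \<iota> r)"
    using f Suc.prems by (simp add: ord_lt_closed closed E.l_distr E.m_assoc)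
  moreover have "\<delta> [^] n \<otimes> \<iota> r \<in> ord_lt (Suc n)"
    using delta_pow_mult_ord_lt[OF left_mult_ord_lt] Suc.prems by simp
  ultimately show ?case using f Suc.prems
    by (metis Suc.IH ord_lt_Suc ord_lt_add ord_lt_left_mult)
qed

text \<open>The order of a product is at most the sum of the orders; with strict bounds this
  reads \<open>m + n\<close> when one of them is \<open>Suc m\<close>.\<close>
lemma ord_lt_mult: "\<lbrakk> f \<in> ord_lt (Suc m); g \<in> ord_lt n \<rbrakk> \<Longrightarrow> f \<otimes> g \<in> ord_lt (m + n)"
proof (induction n arbitrary: g)
  case 0
  then show ?case using ord_lt_zero by (simp add: ord_lt_closed del: ord_lt.simps(2))
next
  case (Suc n)
  obtain g' s where g: "g' \<in> ord_lt n" "s \<in> carrier R" "g = g' \<oplus> \<iota> s \<otimes> \<delta> [^] n"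
    using Suc.prems(2) by (rule ord_lt_SucE)
  have c: "f \<in> carrier E" using Suc.prems(1) by (rule ord_lt_closed)
  have "f \<otimes> g = f \<otimes> g' \<oplus> (f \<otimes> \<iota> s) \<otimes> \<delta> [^] n"
    using g c by (simp add: ord_lt_closed closed E.r_distr E.m_assoc)
  moreover have "(f \<otimes> \<iota> s) \<otimes> \<delta> [^] n \<in> ord_lt (m + Suc n)"
    using ord_lt_mult_delta_pow[OF ord_lt_mult_left_mult[OF Suc.prems(1) g(2)], of n] by simp
  moreover have "f \<otimes> g' \<in> ord_lt (m + Suc n)"
    using ord_lt_Suc[OF Suc.IH[OF Suc.prems(1) g(1)]] by simp
  ultimately show ?case by (metis ord_lt_add)
qed

lemma ord_lt_operators: "f \<in> ord_lt n \<Longrightarrow> f \<in> operators"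
  by (auto simp: operators_def)

lemma operatorsE:
  assumes "f \<in> operators" obtains n where "f \<in> ord_lt n"
  using assms by (auto simp: operators_def)

lemma operators_closed: "f \<in> operators \<Longrightarrow> f \<in> carrier E"
  by (auto simp: operators_def ord_lt_closed)

lemma operators_common_ord:
  assumes "f \<in> operators" "g \<in> operators"
  obtains n where "f \<in> ord_lt (Suc n)" "g \<in> ord_lt (Suc n)"
  using assms by (metis operatorsE ord_lt_mono ord_lt_Suc nat_le_linear)

lemma operators_mult: "\<lbrakk> f \<in> operators; g \<in> operators \<rbrakk> \<Longrightarrow> f \<otimes> g \<in> operators"
  by (metis operators_common_ord ord_lt_mult ord_lt_operators)

lemma operators_add: "\<lbrakk> f \<in> operators; g \<in> operators \<rbrakk> \<Longrightarrow> f \<oplus> g \<in> operators"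
  by (metis operators_common_ord ord_lt_add ord_lt_operators)

lemma operators_minus: "f \<in> operators \<Longrightarrow> \<ominus> f \<in> operators"
  by (metis operatorsE ord_lt_minus ord_lt_operators)

lemma operators_diff: "\<lbrakk> f \<in> operators; g \<in> operators \<rbrakk> \<Longrightarrow> f \<ominus> g \<in> operators"
  by (simp add: E.minus_eq operators_add operators_minus)

lemma operators_zero: "\<zero> \<in> operators"
  using ord_lt_operators[OF ord_lt_zero] .

lemma operators_left_mult: "r \<in> carrier R \<Longrightarrow> \<iota> r \<in> operators"
  using ord_lt_operators[OF left_mult_ord_lt] .

lemma operators_one: "\<one> \<in> operators"
  using operators_left_mult[of "\<one>\<^bsub>R\<^esub>"] by (simp add: left_mult_one)

lemma operators_delta_pow: "\<delta> [^] (n::nat) \<in> operators"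
  using ord_lt_operators[OF pow_ord_lt] .

lemma operators_delta: "\<delta> \<in> operators"
  using operators_delta_pow[of 1] by (simp add: closed)

lemmas operators_intros = operators_mult operators_add operators_minus operators_diff
  operators_zero operators_left_mult operators_one operators_delta_pow operators_delta

lemma operators_subring: "subring operators E"
  by (intro E.subringI) (auto intro: operators_intros operators_closed)

text \<open>Together with \<open>operators_subring\<close> this identifies the operators of finite order with the
  subring generated by \<open>\<delta>\<close> and the multiplications.\<close>
lemma operators_least:
  assumes S: "subring S E" and "\<delta> \<in> S" "\<And>r. r \<in> carrier R \<Longrightarrow> \<iota> r \<in> S"
  shows "operators \<subseteq> S"
proof
  have p: "\<delta> [^] (n::nat) \<in> S" for n
    by (induction n) (use assms subringE[OF S] in auto)
  have "f \<in> S" if "f \<in> ord_lt n" for f n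
    using that by (induction n arbitrary: f) (use assms p subringE[OF S] in auto)
  then show "f \<in> S" if "f \<in> operators" for f using that by (auto elim: operatorsE)
qed

text \<open>Splitting off the coefficient of \<open>\<delta>\<^sup>0\<close> instead of the leading one exposes a right factor \<open>\<delta>\<close>.\<close>
lemma ord_lt_SucE_right:
  assumes "g \<in> ord_lt (Suc n)"
  obtains f r where "f \<in> ord_lt n" "r \<in> carrier R" "g = \<iota> r \<oplus> f \<otimes> \<delta>"
proof -
  have "\<exists>f r. f \<in> ord_lt n \<and> r \<in> carrier R \<and> g = \<iota> r \<oplus> f \<otimes> \<delta>"
    using assms
  proof (induction n arbitrary: g)
    case 0
    then show ?case using ord_lt_zero[of 0] by (auto simp: closed)
  next
    case (Suc n)
    obtain g' s where g: "g' \<in> ord_lt (Suc n)" "s \<in> carrier R" "g = g' \<oplus> \<iota> s \<otimes> \<delta> [^] Suc n"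
      using Suc.prems by (rule ord_lt_SucE)
    obtain f r where f: "f \<in> ord_lt n" "r \<in> carrier R" "g' = \<iota> r \<oplus> f \<otimes> \<delta>"
      using Suc.IH[OF g(1)] by blast
    have "g = \<iota> r \<oplus> (f \<oplus> \<iota> s \<otimes> \<delta> [^] n) \<otimes> \<delta>"
      using f g by (simp add: ord_lt_closed closed E.l_distr E.m_assoc E.a_assoc)
    then show ?case using f g ord_lt_SucI by blast
  qed
  then show thesis using that by blast
qed

lemma ord_lt_finsum: "f \<in> I \<rightarrow> ord_lt n \<Longrightarrow> finsum E f I \<in> ord_lt n"
proof (induction I rule: infinite_finite_induct)
  case (insert i I)
  then show ?case
    by (subst E.finsum_insert) (auto intro!: ord_lt_add ord_lt_closed simp del: ord_lt.simps)
qed (simp_all add: ord_lt_zero)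

lemma operators_finsum: "f \<in> I \<rightarrow> operators \<Longrightarrow> finsum E f I \<in> operators"
proof (induction I rule: infinite_finite_induct)
  case (insert i I)
  then show ?case
    by (subst E.finsum_insert) (auto intro!: operators_add operators_closed)
qed (simp_all add: operators_zero)

lemma op_finsum:
  assumes "f \<in> carrier E"
  shows "x \<in> I \<rightarrow> carrier R \<Longrightarrow> f (finsum R x I) = finsum R (\<lambda>i. f (x i)) I"
proof (induction I rule: infinite_finite_induct)
  case (insert i I)
  then have x: "x \<in> I \<rightarrow> carrier R" "x i \<in> carrier R" by auto
  then have "finsum R x I \<in> carrier R" by (simp add: R.finsum_closed)
  then have "f (finsum R x (insert i I)) = f (x i) \<oplus>\<^bsub>R\<^esub> finsum R (\<lambda>i. f (x i)) I"
    using insert x assms by (simp add: R.finsum_insert op_add)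
  also have "\<dots> = finsum R (\<lambda>i. f (x i)) (insert i I)"
    using insert x assms by (subst R.finsum_insert) (auto intro: op_closed)
  finally show ?case .
qed (simp_all add: assms op_zero)

end

section \<open>Consequences of surjectivity\<close>

text \<open>The second condition of the theorem, for the ring of operators of finite order.\<close>
locale surjective_operator_ring = operator_ring E R \<delta> + R: field R
  for E :: "('r \<Rightarrow> 'r, 'e) ring_scheme" (structure)
    and R :: "('r, 's) ring_scheme"
    and \<delta> :: "'r \<Rightarrow> 'r" +
  assumes delta_nonzero: "\<delta> \<noteq> \<zero>"
    and surjective: "\<lbrakk> f \<in> operators; f \<noteq> \<zero>; x \<in> carrier R \<rbrakk> \<Longrightarrow> \<exists>y \<in> carrier R. f y = x"
begin

text \<open>Induction on the order from below: if \<open>s + h \<delta> = 0\<close>, evaluation at \<open>1\<close> gives \<open>s = 0\<close> because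
  \<open>\<delta> 1 = 0\<close>, and then \<open>h = 0\<close> because \<open>\<delta>\<close> is surjective. In particular no
  power of \<open>\<delta>\<close> satisfies a linear relation over \<open>R\<close> with lower powers, in any characteristic.\<close>
lemma leading_coefficient_zero:
  assumes "g \<in> ord_lt n" "r \<in> carrier R" "g \<oplus> \<iota> r \<otimes> \<delta> [^] n = \<zero>"
  shows "r = \<zero>\<^bsub>R\<^esub>"
  using assms
proof (induction n arbitrary: g)
  case 0
  then have "\<iota> r = \<zero>" by (simp add: closed)
  then have "\<iota> r \<one>\<^bsub>R\<^esub> = \<zero>\<^bsub>R\<^esub>" by (simp add: zero_apply)
  then show ?case using 0 by (simp add: applies)
next
  case (Suc n)
  obtain f s where f: "f \<in> ord_lt n" "s \<in> carrier R" "g = \<iota> s \<oplus> f \<otimes> \<delta>"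
    using Suc.prems(1) by (rule ord_lt_SucE_right)
  define h where "h = f \<oplus> \<iota> r \<otimes> \<delta> [^] n"
  have h: "h \<in> carrier E" using f Suc.prems by (simp add: h_def ord_lt_closed closed)
  have eq: "\<iota> s \<oplus> h \<otimes> \<delta> = \<zero>"
    using f Suc.prems by (simp add: h_def ord_lt_closed closed E.l_distr E.m_assoc E.a_assoc)
  have "(\<iota> s \<oplus> h \<otimes> \<delta>) \<one>\<^bsub>R\<^esub> = s"
    using f h by (simp add: closed applies delta_one op_zero)
  with eq have "s = \<zero>\<^bsub>R\<^esub>" by (simp add: zero_apply)
  with eq h have hd: "h \<otimes> \<delta> = \<zero>" by (simp add: left_mult_zero closed)
  have "h = \<zero>"
  proof (rule op_eqI)
    fix x assume "x \<in> carrier R"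
    then obtain y where y: "y \<in> carrier R" "\<delta> y = x"
      using surjective[OF operators_delta delta_nonzero] by blast
    then have "h x = (h \<otimes> \<delta>) y" using h by (simp add: applies closed)
    with hd y \<open>x \<in> carrier R\<close> show "h x = \<zero> x" by (simp add: zero_apply)
  qed (use h in auto)
  then show ?case using Suc.IH[OF f(1)] Suc.prems unfolding h_def by blast
qed

lemma leading_coefficient_unique:
  assumes "r \<in> carrier R" "f \<in> ord_lt n" "f \<oplus> \<iota> r \<otimes> \<delta> [^] n \<in> ord_lt n"
  shows "r = \<zero>\<^bsub>R\<^esub>"
proof (rule leading_coefficient_zero)
  let ?g = "f \<ominus> (f \<oplus> \<iota> r \<otimes> \<delta> [^] n)"
  show "?g \<in> ord_lt n" using assms by (simp add: ord_lt_diff)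
  have c: "f \<in> carrier E" "\<iota> r \<otimes> \<delta> [^] n \<in> carrier E" 
    using assms by (simp_all add: ord_lt_closed closed)
  show "?g \<oplus> \<iota> r \<otimes> \<delta> [^] n = \<zero>"
    using c by (simp add: E.minus_eq E.minus_add E.a_ac E.r_neg E.r_neg1 E.l_neg)
qed (rule assms(1))

text \<open>Consider a left relation between the rows of \<open>L\<close> whose coefficients have order at most \<open>m\<close>. In its \<open>j\<close>-th column the
  only term of order \<open>m + n\<close> comes from the diagonal entry \<open>\<delta>\<^sup>n\<close>, so the coefficient of \<open>\<delta>\<^sup>m\<close> in
  \<open>d j\<close> vanishes. Descending on \<open>m\<close> makes all coefficients zero.\<close>
lemma monic_matrix_regular:
  fixes N :: nat
  assumes L: "\<And>i j. L i j = M i j \<oplus> (if i = j then \<delta> [^] n else \<zero>)"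
    and M: "\<And>i j. M i j \<in> ord_lt n"
    and d: "\<And>i. d i \<in> operators"
    and rel: "\<And>j. j < N \<Longrightarrow> (\<Oplus>i\<in>{..<N}. d i \<otimes> L i j) = \<zero>"
    and i: "i < N"
  shows "d i = \<zero>"
proof -
  have "d i = \<zero>" if "\<forall>i<N. d i \<in> ord_lt m" for m
    using that
  proof (induction m)
    case 0
    then show ?case using i by simp
  next
    case (Suc m)
    have "d j \<in> ord_lt m" if j: "j < N" for j
    proof -
      let ?S = "\<Oplus>i\<in>{..<N}. d i \<otimes> M i j"
      have c: "d i \<in> carrier E" "M i j \<in> carrier E" for i j
        using d M by (auto intro: operators_closed ord_lt_closed)
      have "(\<Oplus>i\<in>{..<N}. d i \<otimes> L i j) =
          (\<Oplus>i\<in>{..<N}. d i \<otimes> M i j \<oplus> (if j = i then d i \<otimes> \<delta> [^] n else \<zero>))"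
        using c by (intro E.finsum_cong') (auto simp: L closed E.r_distr)
      also have "\<dots> = ?S \<oplus> (\<Oplus>i\<in>{..<N}. (if j = i then d i \<otimes> \<delta> [^] n else \<zero>))"
        using c by (intro E.finsum_addf) (auto simp: closed)
      also have "(\<Oplus>i\<in>{..<N}. (if j = i then d i \<otimes> \<delta> [^] n else \<zero>)) = d j \<otimes> \<delta> [^] n"
        using c j by (subst E.finsum_singleton) (auto simp: closed)
      finally have "?S \<oplus> d j \<otimes> \<delta> [^] n = \<zero>" using rel[OF j] by simp
      moreover have S: "?S \<in> ord_lt (m + n)"
        using Suc.prems M by (intro ord_lt_finsum) (auto intro!: ord_lt_mult simp del: ord_lt.simps)
      ultimately have "\<ominus> ?S = d j \<otimes> \<delta> [^] n"
        using c ord_lt_closed[OF S] by (intro E.minus_equality) (simp_all add: closed E.a_comm)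
      then have "d j \<otimes> \<delta> [^] n = \<ominus> ?S" by simp
      with S have dj: "d j \<otimes> \<delta> [^] n \<in> ord_lt (m + n)" by (simp add: ord_lt_minus)
      have "d j \<in> ord_lt (Suc m)" using Suc.prems j by blast
      then obtain f r where f: "f \<in> ord_lt m" "r \<in> carrier R" "d j = f \<oplus> \<iota> r \<otimes> \<delta> [^] m"
        by (rule ord_lt_SucE)
      have "d j \<otimes> \<delta> [^] n = f \<otimes> \<delta> [^] n \<oplus> \<iota> r \<otimes> \<delta> [^] (m + n)"
        using f by (simp add: ord_lt_closed closed E.l_distr E.m_assoc E.nat_pow_mult)
      with dj have "r = \<zero>\<^bsub>R\<^esub>"
        using leading_coefficient_unique[of r "f \<otimes> \<delta> [^] n" "m + n"] f ord_lt_mult_delta_pow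
        by simp
      then show ?thesis using f by (simp add: left_mult_zero ord_lt_closed closed)
    qed
    then show ?case using Suc.IH by blast
  qed
  moreover have "\<exists>m. \<forall>i<N. d i \<in> ord_lt m"
  proof -
    have "\<exists>k. d i \<in> ord_lt k" for i using d[of i] by (auto elim: operatorsE)
    then obtain k where k: "\<And>i. d i \<in> ord_lt (k i)" by metis
    have "d i \<in> ord_lt (Max (k ` {..<N}))" if "i < N" for i
      using that by (intro ord_lt_mono[OF _ k]) simp
    then show ?thesis by blast
  qed
  ultimately show ?thesis by blast
qed

text \<open>Division with remainder by a nonzero element \<open>h\<close> of least order \<open>m\<close>: multiplying \<open>h\<close> on the
  left by \<open>r \<delta>\<^sup>e s\<^sup>-\<^sup>1\<close>, where \<open>s\<close> is the leading coefficient of \<open>h\<close>, produces the leading term \<open>r \<delta>\<^sup>m\<^sup>+\<^sup>e\<close>.\<close>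
lemma left_ideal_principal:
  assumes J: "J \<subseteq> operators" "J \<noteq> {}"
    and diff: "\<And>f g. \<lbrakk> f \<in> J; g \<in> J \<rbrakk> \<Longrightarrow> f \<ominus> g \<in> J"
    and mult: "\<And>d f. \<lbrakk> d \<in> operators; f \<in> J \<rbrakk> \<Longrightarrow> d \<otimes> f \<in> J"
  obtains h where "h \<in> J" "\<And>g. g \<in> J \<Longrightarrow> \<exists>d \<in> operators. g = d \<otimes> h"
proof (cases "J \<subseteq> {\<zero>}")
  case True
  then have "\<zero> \<in> J" using J by blast
  moreover have "\<exists>d \<in> operators. g = d \<otimes> \<zero>" if "g \<in> J" for g
    using that True operators_zero by (intro bexI[of _ \<zero>]) auto
  ultimately show thesis by (rule that)
next
  case False
  define m where "m = (LEAST m. \<exists>h\<in>J. h \<noteq> \<zero> \<and> h \<in> ord_lt (Suc m))"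
  obtain h0 where "h0 \<in> J" "h0 \<noteq> \<zero>" using False by blast
  moreover obtain k where "h0 \<in> ord_lt k" using calculation J by (auto elim: operatorsE)
  ultimately have "\<exists>m. \<exists>h\<in>J. h \<noteq> \<zero> \<and> h \<in> ord_lt (Suc m)" using ord_lt_Suc by blast
  then have "\<exists>h\<in>J. h \<noteq> \<zero> \<and> h \<in> ord_lt (Suc m)" unfolding m_def by (rule LeastI_ex)
  then obtain h where h: "h \<in> J" "h \<noteq> \<zero>" "h \<in> ord_lt (Suc m)" by blast
  have least: "g = \<zero>" if "g \<in> J" "g \<in> ord_lt m" for g
  proof (cases m)
    case 0
    then show ?thesis using that by simp
  next
    case (Suc l)
    then show ?thesis using not_less_Least[of l "\<lambda>m. \<exists>h\<in>J. h \<noteq> \<zero> \<and> h \<in> ord_lt (Suc m)"] that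
      by (auto simp flip: m_def simp del: ord_lt.simps)
  qed
  obtain f s where f: "f \<in> ord_lt m" "s \<in> carrier R" "h = f \<oplus> \<iota> s \<otimes> \<delta> [^] m"
    using h(3) by (rule ord_lt_SucE)
  have s: "s \<in> Units R"
  proof -
    have "s \<noteq> \<zero>\<^bsub>R\<^esub>"
      using f h least[OF h(1)] by (auto simp: left_mult_zero ord_lt_closed closed)
    then show ?thesis using f R.field_Units by blast
  qed
  have hc: "h \<in> carrier E" using h(3) by (rule ord_lt_closed)
  have "\<exists>d \<in> operators. g = d \<otimes> h" if "g \<in> J" "g \<in> ord_lt k" for g k
    using that
  proof (induction k arbitrary: g)
    case 0
    then show ?case using operators_zero hc by (intro bexI[of _ \<zero>]) auto
  next
    case (Suc k)
    show ?case
    proof (cases "Suc k \<le> m")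
      case True
      then have "g = \<zero>" using Suc.prems ord_lt_mono least by blast
      then show ?thesis using operators_zero hc by (intro bexI[of _ \<zero>]) auto
    next
      case False
      define e where "e = k - m"
      have k: "k = m + e" using False by (simp add: e_def)
      obtain g' r where g: "g' \<in> ord_lt k" "r \<in> carrier R" "g = g' \<oplus> \<iota> r \<otimes> \<delta> [^] k"
        using Suc.prems(2) by (rule ord_lt_SucE)
      define d where "d = \<iota> r \<otimes> (\<delta> [^] e \<otimes> \<iota> (inv\<^bsub>R\<^esub> s))"
      have d: "d \<in> operators"
        using g s by (simp add: d_def operators_intros)
      have "\<iota> (inv\<^bsub>R\<^esub> s) \<otimes> h = \<iota> (inv\<^bsub>R\<^esub> s) \<otimes> f \<oplus> \<delta> [^] m"
      proof -
        have "\<iota> (inv\<^bsub>R\<^esub> s) \<otimes> \<iota> s = \<one>"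
          using s f by (simp add: left_mult_mult[symmetric] left_mult_one)
        then show ?thesis using s f
          by (simp add: closed ord_lt_closed E.r_distr E.m_assoc[symmetric])
      qed
      then have "d \<otimes> h = \<iota> r \<otimes> (\<delta> [^] e \<otimes> (\<iota> (inv\<^bsub>R\<^esub> s) \<otimes> f \<oplus> \<delta> [^] m))"
        using g s hc by (simp add: d_def closed E.m_assoc)
      also have "\<dots> = \<iota> r \<otimes> (\<delta> [^] e \<otimes> (\<iota> (inv\<^bsub>R\<^esub> s) \<otimes> f)) \<oplus> \<iota> r \<otimes> \<delta> [^] k"
        using g s f by (simp add: closed ord_lt_closed E.r_distr k E.nat_pow_mult add.commute)
      finally have dh: "d \<otimes> h = \<iota> r \<otimes> (\<delta> [^] e \<otimes> (\<iota> (inv\<^bsub>R\<^esub> s) \<otimes> f)) \<oplus> \<iota> r \<otimes> \<delta> [^] k" .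
      have low: "\<iota> r \<otimes> (\<delta> [^] e \<otimes> (\<iota> (inv\<^bsub>R\<^esub> s) \<otimes> f)) \<in> ord_lt k" (is "?l \<in> _")
        unfolding k using g s f by (intro ord_lt_left_mult delta_pow_mult_ord_lt) auto
      have "g \<ominus> d \<otimes> h = g' \<ominus> ?l"
        unfolding dh g(3) using ord_lt_closed[OF g(1)] ord_lt_closed[OF low] g(2)
        by (simp add: closed E.minus_eq E.minus_add E.a_ac E.r_neg2)
      then have "g \<ominus> d \<otimes> h \<in> ord_lt k" using g low by (simp add: ord_lt_diff)
      moreover have "g \<ominus> d \<otimes> h \<in> J" using Suc.prems d h diff mult by blast
      ultimately obtain d' where d': "d' \<in> operators" "g \<ominus> d \<otimes> h = d' \<otimes> h"
        using Suc.IH by blast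
      have gc: "g \<in> carrier E" using Suc.prems ord_lt_closed by blast
      have "g = (g \<ominus> d \<otimes> h) \<oplus> d \<otimes> h"
        using gc hc operators_closed[OF d] by (simp add: E.minus_eq E.a_assoc E.l_neg)
      also have "\<dots> = (d' \<oplus> d) \<otimes> h"
        using d' operators_closed[OF d] operators_closed[OF d'(1)] hc by (simp add: E.l_distr)
      finally show ?thesis using d d'(1) operators_add by blast
    qed
  qed
  then show thesis using that h(1) J by (metis operatorsE subsetD)
qed

end

section \<open>Linear differential systems\<close>

context surjective_operator_ring
begin

text \<open>Injectivity of the left module \<open>R\<close> over the ring \<open>D\<close> of operators, for free modules of finite rank. The set \<open>T\<close> is the graph
  of a \<open>D\<close>-linear map from a submodule of \<open>D\<^sup>N\<close> to \<open>R\<close>, and a \<open>D\<close>-linear extension to all of \<open>D\<^sup>N\<close> is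
  given by the images \<open>Y j\<close> of the unit vectors. The rank is raised by one as in Baer's criterion: the last coordinates of
  the submodule form a left ideal \<open>D h\<close>, and \<open>Y N\<close> only has to be correct on one vector
  with last coordinate \<open>h\<close>, which is an equation \<open>h y = x\<close>.\<close>
lemma functional_extension:
  fixes N :: nat
  assumes "T \<subseteq> (UNIV \<rightarrow> operators) \<times> carrier R" "T \<noteq> {}"
    and "\<And>g r g' r'. \<lbrakk> (g, r) \<in> T; (g', r') \<in> T \<rbrakk> \<Longrightarrow> (\<lambda>j. g j \<ominus> g' j, r \<ominus>\<^bsub>R\<^esub> r') \<in> T"
    and "\<And>d g r. \<lbrakk> d \<in> operators; (g, r) \<in> T \<rbrakk> \<Longrightarrow> (\<lambda>j. d \<otimes> g j, d r) \<in> T"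
    and "\<And>g r. \<lbrakk> (g, r) \<in> T; \<And>j. j < N \<Longrightarrow> g j = \<zero> \<rbrakk> \<Longrightarrow> r = \<zero>\<^bsub>R\<^esub>"
  shows "\<exists>Y \<in> UNIV \<rightarrow> carrier R. \<forall>g r. (g, r) \<in> T \<longrightarrow> (\<Oplus>\<^bsub>R\<^esub>j\<in>{..<N}. g j (Y j)) = r"
  using assms
proof (induction N arbitrary: T)
  case 0
  then show ?case by (intro bexI[of _ "\<lambda>_. \<zero>\<^bsub>R\<^esub>"]) auto
next
  case (Suc N)
  note T = Suc.prems
  have g_in: "g j \<in> operators" and g_closed: "g j \<in> carrier E" and r_closed: "r \<in> carrier R"
    if "(g, r) \<in> T" for g r j
    using that T(1) operators_closed by auto
  define T0 where "T0 = {(g, r) \<in> T. g N = \<zero>}"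
  have "\<exists>Y \<in> UNIV \<rightarrow> carrier R. \<forall>g r. (g, r) \<in> T0 \<longrightarrow> (\<Oplus>\<^bsub>R\<^esub>j\<in>{..<N}. g j (Y j)) = r"
  proof (rule Suc.IH)
    show "T0 \<subseteq> (UNIV \<rightarrow> operators) \<times> carrier R" using T(1) by (auto simp: T0_def)
    obtain g r where gr: "(g, r) \<in> T" using T(2) by fast
    show "T0 \<noteq> {}" using T(3)[OF gr gr] g_closed[OF gr] by (auto simp: T0_def)
    show "(\<lambda>j. g j \<ominus> g' j, r \<ominus>\<^bsub>R\<^esub> r') \<in> T0" if "(g, r) \<in> T0" "(g', r') \<in> T0" for g r g' r'
      using that T(3) by (auto simp: T0_def E.minus_eq)
    show "(\<lambda>j. d \<otimes> g j, d r) \<in> T0" if "d \<in> operators" "(g, r) \<in> T0" for d g r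
      using that T(4) by (auto simp: T0_def operators_closed)
    show "r = \<zero>\<^bsub>R\<^esub>" if "(g, r) \<in> T0" "\<And>j. j < N \<Longrightarrow> g j = \<zero>" for g r
      using that T(5)[of g r] by (auto simp: T0_def less_Suc_eq)
  qed
  then obtain Y where Y: "Y \<in> UNIV \<rightarrow> carrier R"
    and Y0: "\<And>g r. (g, r) \<in> T0 \<Longrightarrow> (\<Oplus>\<^bsub>R\<^esub>j\<in>{..<N}. g j (Y j)) = r" by blast
  have Yc: "Y j \<in> carrier R" for j using Y by auto
  define ev :: "(nat \<Rightarrow> 'r \<Rightarrow> 'r) \<Rightarrow> 'r" where "ev = (\<lambda>g. \<Oplus>\<^bsub>R\<^esub>j\<in>{..<N}. g j (Y j))"
  have ev_closed: "ev g \<in> carrier R" if "(g, r) \<in> T" for g r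
    unfolding ev_def using Yc g_closed[OF that] by (intro R.finsum_closed) (simp add: op_closed)
  define J where "J = (\<lambda>(g, r). g N) ` T"
  have J: "J \<subseteq> operators" "J \<noteq> {}" using g_in T(2) by (auto simp: J_def)
  have J_diff: "f \<ominus> g \<in> J" if fg: "f \<in> J" "g \<in> J" for f g
  proof -
    obtain f' r g' s where "(f', r) \<in> T" "f = f' N" "(g', s) \<in> T" "g = g' N"
      using fg by (auto simp: J_def)
    then show ?thesis using T(3)[of f' r g' s] unfolding J_def by (intro rev_image_eqI[of "(\<lambda>j. f' j \<ominus> g' j, r \<ominus>\<^bsub>R\<^esub> s)"]) auto
  qed
  have J_mult: "d \<otimes> f \<in> J" if df: "d \<in> operators" "f \<in> J" for d f
  proof -
    obtain f' r where "(f', r) \<in> T" "f = f' N" using df by (auto simp: J_def)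
    then show ?thesis using T(4)[of d f' r] df unfolding J_def by (intro rev_image_eqI[of "(\<lambda>j. d \<otimes> f' j, d r)"]) auto
  qed
  obtain h where "h \<in> J" and h: "\<And>g. g \<in> J \<Longrightarrow> \<exists>d \<in> operators. g = d \<otimes> h"
    using left_ideal_principal[OF J J_diff J_mult] by blast
  then obtain g0 r0 where g0: "(g0, r0) \<in> T" "h = g0 N" by (auto simp: J_def)
  \<comment> \<open>If \<open>h = 0\<close>, then the vector \<open>g0\<close> lies in the part already treated and any \<open>y\<close> will do.\<close>
  have "\<exists>y \<in> carrier R. h y = r0 \<ominus>\<^bsub>R\<^esub> ev g0"
  proof (cases "h = \<zero>")
    case True
    then have "(g0, r0) \<in> T0" using g0 by (simp add: T0_def)
    then have "ev g0 = r0" using Y0 by (simp add: ev_def)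
    then show ?thesis using True r_closed[OF g0(1)]
      by (intro bexI[of _ "\<zero>\<^bsub>R\<^esub>"]) (auto simp: zero_apply R.minus_eq R.r_neg)
  next
    case False
    then show ?thesis
      using surjective g_in[OF g0(1)] r_closed[OF g0(1)] ev_closed[OF g0(1)] g0(2) by simp
  qed
  then obtain y where y: "y \<in> carrier R" "h y = r0 \<ominus>\<^bsub>R\<^esub> ev g0" by blast
  have "(\<Oplus>\<^bsub>R\<^esub>j\<in>{..<Suc N}. g j ((Y(N := y)) j)) = r" if gr: "(g, r) \<in> T" for g r
  proof -
    have "g N \<in> J" using gr by (auto simp: J_def intro: rev_image_eqI)
    then obtain d where d: "d \<in> operators" "g N = d \<otimes> h" using h by blast
    have dc: "d \<in> carrier E" using d operators_closed by blast
    note dg = T(4)[OF d(1) g0(1)]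
    note c = g_closed[OF gr] g_closed[OF g0(1)] r_closed[OF gr] r_closed[OF g0(1)]
      ev_closed[OF gr] ev_closed[OF g0(1)] dc
    \<comment> \<open>Subtracting a multiple of the distinguished vector clears the last coordinate.\<close>
    have "(\<lambda>j. g j \<ominus> d \<otimes> g0 j, r \<ominus>\<^bsub>R\<^esub> d r0) \<in> T0"
      using T(3)[OF gr dg] d g0 c by (simp add: T0_def)
    then have "r \<ominus>\<^bsub>R\<^esub> d r0 = (\<Oplus>\<^bsub>R\<^esub>j\<in>{..<N}. (g j \<ominus> d \<otimes> g0 j) (Y j))"
      by (rule Y0[symmetric])
    also have "\<dots> = (\<Oplus>\<^bsub>R\<^esub>j\<in>{..<N}. g j (Y j) \<oplus>\<^bsub>R\<^esub> (\<ominus>\<^bsub>R\<^esub> d (g0 j (Y j))))"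
      using c Yc by (intro R.finsum_cong') (auto simp: diff_apply applies R.minus_eq op_closed)
    also have "\<dots> = ev g \<oplus>\<^bsub>R\<^esub> (\<Oplus>\<^bsub>R\<^esub>j\<in>{..<N}. (\<ominus> d) (g0 j (Y j)))"
      unfolding ev_def using c Yc
      by (subst R.finsum_addf) (auto simp: minus_apply op_closed intro!: R.finsum_cong')
    also have "(\<Oplus>\<^bsub>R\<^esub>j\<in>{..<N}. (\<ominus> d) (g0 j (Y j))) = (\<ominus> d) (ev g0)"
      unfolding ev_def using c Yc by (subst op_finsum) (auto simp: op_closed)
    finally have eq: "r \<ominus>\<^bsub>R\<^esub> d r0 = ev g \<ominus>\<^bsub>R\<^esub> d (ev g0)"
      using c by (simp add: minus_apply R.minus_eq)
    have "(\<Oplus>\<^bsub>R\<^esub>j\<in>{..<Suc N}. g j ((Y(N := y)) j)) = g N y \<oplus>\<^bsub>R\<^esub> ev g"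
    proof -
      have "(\<Oplus>\<^bsub>R\<^esub>j\<in>{..<N}. g j ((Y(N := y)) j)) = ev g"
        unfolding ev_def using c Yc by (intro R.finsum_cong') (auto simp: op_closed)
      moreover have "(\<Oplus>\<^bsub>R\<^esub>j\<in>{..<Suc N}. g j ((Y(N := y)) j)) =
          g N y \<oplus>\<^bsub>R\<^esub> (\<Oplus>\<^bsub>R\<^esub>j\<in>{..<N}. g j ((Y(N := y)) j))"
        unfolding lessThan_Suc using c Yc y by (subst R.finsum_insert) (auto simp: op_closed)
      ultimately show ?thesis by simp
    qed
    also have "g N y = d r0 \<ominus>\<^bsub>R\<^esub> d (ev g0)"
      using d(2) g0(2) c y by (simp add: mult_apply op_diff)
    also have "(d r0 \<ominus>\<^bsub>R\<^esub> d (ev g0)) \<oplus>\<^bsub>R\<^esub> ev g = d r0 \<oplus>\<^bsub>R\<^esub> (ev g \<ominus>\<^bsub>R\<^esub> d (ev g0))"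
      using c by (simp add: R.minus_eq R.a_ac op_closed)
    also have "\<dots> = d r0 \<oplus>\<^bsub>R\<^esub> (r \<ominus>\<^bsub>R\<^esub> d r0)" using eq by simp
    also have "\<dots> = r" using c by (simp add: R.minus_eq R.a_ac op_closed R.r_neg)
    finally show ?thesis .
  qed
  then show ?case using Y y by (intro bexI[of _ "Y(N := y)"]) auto
qed

lemma add_eq_imp_eq_diff:
  "\<lbrakk> f \<oplus> g = h; f \<in> carrier E; g \<in> carrier E \<rbrakk> \<Longrightarrow> f = h \<ominus> g"
  by (auto simp: E.minus_eq E.a_assoc E.r_neg)

lemma add_eq_imp_eq_diff_R:
  "\<lbrakk> x \<oplus>\<^bsub>R\<^esub> y = z; x \<in> carrier R; y \<in> carrier R \<rbrakk> \<Longrightarrow> x = z \<ominus>\<^bsub>R\<^esub> y"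
  by (auto simp: R.minus_eq R.a_assoc R.r_neg)

lemma finsum_diff_mult:
  assumes "\<And>i. d i \<in> carrier E" "\<And>i. d' i \<in> carrier E" "\<And>i. f i \<in> carrier E"
  shows "(\<Oplus>i\<in>I. (d i \<ominus> d' i) \<otimes> f i) = (\<Oplus>i\<in>I. d i \<otimes> f i) \<ominus> (\<Oplus>i\<in>I. d' i \<otimes> f i)"
proof -
  have "(\<Oplus>i\<in>I. (d i \<ominus> d' i) \<otimes> f i) \<oplus> (\<Oplus>i\<in>I. d' i \<otimes> f i) =
      (\<Oplus>i\<in>I. (d i \<ominus> d' i) \<otimes> f i \<oplus> d' i \<otimes> f i)"
    using assms by (intro E.finsum_addf[symmetric]) auto
  also have "\<dots> = (\<Oplus>i\<in>I. d i \<otimes> f i)"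
    using assms by (intro E.finsum_cong')
      (auto simp: E.minus_eq E.l_distr E.l_minus E.a_assoc E.l_neg)
  finally show ?thesis using assms
    by (intro add_eq_imp_eq_diff) (auto intro!: E.finsum_closed)
qed

lemma finsum_apply_diff:
  assumes "\<And>i. d i \<in> carrier E" "\<And>i. d' i \<in> carrier E" "\<And>i. x i \<in> carrier R"
  shows "(\<Oplus>\<^bsub>R\<^esub>i\<in>I. (d i \<ominus> d' i) (x i)) =
    (\<Oplus>\<^bsub>R\<^esub>i\<in>I. d i (x i)) \<ominus>\<^bsub>R\<^esub> (\<Oplus>\<^bsub>R\<^esub>i\<in>I. d' i (x i))"
proof -
  have "(\<Oplus>\<^bsub>R\<^esub>i\<in>I. (d i \<ominus> d' i) (x i)) \<oplus>\<^bsub>R\<^esub> (\<Oplus>\<^bsub>R\<^esub>i\<in>I. d' i (x i)) =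
      (\<Oplus>\<^bsub>R\<^esub>i\<in>I. (d i \<ominus> d' i) (x i) \<oplus>\<^bsub>R\<^esub> d' i (x i))"
    using assms by (intro R.finsum_addf[symmetric]) (simp_all add: Pi_def op_closed)
  also have "\<dots> = (\<Oplus>\<^bsub>R\<^esub>i\<in>I. d i (x i))"
    using assms by (intro R.finsum_cong')
      (auto simp: op_closed diff_apply R.minus_eq R.a_assoc R.l_neg)
  finally show ?thesis using assms
    by (intro add_eq_imp_eq_diff_R R.finsum_closed) (simp_all add: Pi_def op_closed)
qed

text \<open>The rows of \<open>L\<close> are linearly independent over \<open>D\<close> by \<open>monic_matrix_regular\<close>, so sending the
  \<open>i\<close>-th row to \<open>B i\<close> is a well-defined linear map on the submodule they span. An extension
  to the whole free module is a solution of the system.\<close>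
lemma monic_system_solvable:
  fixes N :: nat
  assumes L: "\<And>i j. L i j = M i j \<oplus> (if i = j then \<delta> [^] n else \<zero>)"
    and M: "\<And>i j. M i j \<in> ord_lt n"
    and B: "\<And>i. B i \<in> carrier R"
  shows "\<exists>Y \<in> UNIV \<rightarrow> carrier R. \<forall>i<N. (\<Oplus>\<^bsub>R\<^esub>j\<in>{..<N}. L i j (Y j)) = B i"
proof -
  define G where "G d = (\<lambda>j. \<Oplus>i\<in>{..<N}. d i \<otimes> L i j, \<Oplus>\<^bsub>R\<^esub>i\<in>{..<N}. d i (B i))"
    for d :: "nat \<Rightarrow> 'r \<Rightarrow> 'r"
  define T where "T = G ` (UNIV \<rightarrow> operators)"
  have Lo: "L i j \<in> operators" for i j
    unfolding L using ord_lt_operators[OF M] by (simp add: operators_intros)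
  then have Lc: "L i j \<in> carrier E" for i j by (rule operators_closed)
  have dc: "d i \<in> carrier E" if "d \<in> UNIV \<rightarrow> operators" for d and i :: nat
    using that operators_closed by auto
  have "\<exists>Y \<in> UNIV \<rightarrow> carrier R. \<forall>g r. (g, r) \<in> T \<longrightarrow> (\<Oplus>\<^bsub>R\<^esub>j\<in>{..<N}. g j (Y j)) = r"
  proof (rule functional_extension)
    show "T \<subseteq> (UNIV \<rightarrow> operators) \<times> carrier R"
    proof -
      have "(\<Oplus>i\<in>{..<N}. d i \<otimes> L i j) \<in> operators" if "d \<in> UNIV \<rightarrow> operators" for d j
        using that Lo by (intro operators_finsum) (auto intro: operators_mult)
      moreover have "(\<Oplus>\<^bsub>R\<^esub>i\<in>{..<N}. d i (B i)) \<in> carrier R" if "d \<in> UNIV \<rightarrow> operators" for d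
        using dc[OF that] B by (intro R.finsum_closed) (simp add: op_closed)
      ultimately show ?thesis by (auto simp: T_def G_def)
    qed
    show "T \<noteq> {}" using operators_zero by (auto simp: T_def Pi_def)
  next
    fix g r g' r' assume "(g, r) \<in> T" "(g', r') \<in> T"
    then obtain d d' where d: "d \<in> UNIV \<rightarrow> operators" "(g, r) = G d"
      "d' \<in> UNIV \<rightarrow> operators" "(g', r') = G d'" by (auto simp: T_def)
    have "(\<lambda>j. g j \<ominus> g' j, r \<ominus>\<^bsub>R\<^esub> r') = G (\<lambda>i. d i \<ominus> d' i)"
      using d dc[OF d(1)] dc[OF d(3)] Lc B
      by (simp add: G_def finsum_diff_mult finsum_apply_diff)
    moreover have "(\<lambda>i. d i \<ominus> d' i) \<in> UNIV \<rightarrow> operators" using d by (auto intro: operators_diff)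
    ultimately show "(\<lambda>j. g j \<ominus> g' j, r \<ominus>\<^bsub>R\<^esub> r') \<in> T" by (auto simp: T_def)
  next
    fix e g r assume e: "e \<in> operators" and "(g, r) \<in> T"
    then obtain d where d: "d \<in> UNIV \<rightarrow> operators" "(g, r) = G d" by (auto simp: T_def)
    note c = dc[OF d(1)] Lc B operators_closed[OF e]
    have "e \<otimes> (\<Oplus>i\<in>{..<N}. d i \<otimes> L i j) = (\<Oplus>i\<in>{..<N}. (e \<otimes> d i) \<otimes> L i j)" for j
      using c by (subst E.finsum_rdistr) (auto intro!: E.finsum_cong' simp: E.m_assoc)
    moreover have "e (\<Oplus>\<^bsub>R\<^esub>i\<in>{..<N}. d i (B i)) = (\<Oplus>\<^bsub>R\<^esub>i\<in>{..<N}. (e \<otimes> d i) (B i))"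
      using c by (subst op_finsum) (auto intro!: R.finsum_cong' simp: op_closed mult_apply)
    ultimately have "(\<lambda>j. e \<otimes> g j, e r) = G (\<lambda>i. e \<otimes> d i)"
      using d by (simp add: G_def)
    moreover have "(\<lambda>i. e \<otimes> d i) \<in> UNIV \<rightarrow> operators" using d e by (auto intro: operators_mult)
    ultimately show "(\<lambda>j. e \<otimes> g j, e r) \<in> T" by (auto simp: T_def)
  next
    fix g r assume "(g, r) \<in> T" and z: "\<And>j. j < N \<Longrightarrow> g j = \<zero>"
    then obtain d where d: "d \<in> UNIV \<rightarrow> operators" "(g, r) = G d" by (auto simp: T_def)
    have "d i = \<zero>" if "i < N" for i
      using monic_matrix_regular[OF L M, of d N i] d z that by (auto simp: G_def)
    then have "(\<Oplus>\<^bsub>R\<^esub>i\<in>{..<N}. d i (B i)) = (\<Oplus>\<^bsub>R\<^esub>i\<in>{..<N}. \<zero>\<^bsub>R\<^esub>)"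
      using B by (intro R.finsum_cong') (simp_all add: zero_apply)
    then show "r = \<zero>\<^bsub>R\<^esub>" using d by (simp add: G_def)
  qed
  then obtain Y where Y: "Y \<in> UNIV \<rightarrow> carrier R"
    "\<And>g r. (g, r) \<in> T \<Longrightarrow> (\<Oplus>\<^bsub>R\<^esub>j\<in>{..<N}. g j (Y j)) = r" by blast
  have "(\<Oplus>\<^bsub>R\<^esub>j\<in>{..<N}. L i j (Y j)) = B i" if i: "i < N" for i
  proof -
    define d where "d k = (if i = k then \<one> else \<zero>)" for k :: nat
    have "(\<Oplus>k\<in>{..<N}. d k \<otimes> L k j) = L i j" for j
    proof -
      have "(\<Oplus>k\<in>{..<N}. d k \<otimes> L k j) = (\<Oplus>k\<in>{..<N}. if i = k then L k j else \<zero>)"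
        using Lc by (intro E.finsum_cong') (auto simp: d_def)
      also have "\<dots> = L i j" using Lc i by (subst E.finsum_singleton) auto
      finally show ?thesis .
    qed
    moreover have "(\<Oplus>\<^bsub>R\<^esub>k\<in>{..<N}. d k (B k)) = B i"
    proof -
      have "(\<Oplus>\<^bsub>R\<^esub>k\<in>{..<N}. d k (B k)) = (\<Oplus>\<^bsub>R\<^esub>k\<in>{..<N}. if i = k then B k else \<zero>\<^bsub>R\<^esub>)"
        using B by (intro R.finsum_cong') (auto simp: d_def one_apply zero_apply)
      also have "\<dots> = B i" using B i by (subst R.finsum_singleton) auto
      finally show ?thesis .
    qed
    ultimately have "(L i, B i) = G d" by (simp add: G_def)
    moreover have "d \<in> UNIV \<rightarrow> operators" by (auto simp: d_def operators_intros)
    ultimately have "(L i, B i) \<in> T" by (auto simp: T_def)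
    then show ?thesis by (rule Y(2))
  qed
  then show ?thesis using Y(1) by blast
qed

end

section \<open>Reduction modulo a principal left ideal\<close>

context operator_ring
begin

text \<open>The operator with coefficients \<open>x 0, \<dots>, x (n - 1)\<close>. Modulo a monic operator of order \<open>n\<close>
  these are the coordinates of a residue class.\<close>
primrec diff_op :: "nat \<Rightarrow> (nat \<Rightarrow> 'r) \<Rightarrow> 'r \<Rightarrow> 'r" where
  "diff_op 0 x = \<zero>"
| "diff_op (Suc n) x = diff_op n x \<oplus> \<iota> (x n) \<otimes> \<delta> [^] n"

lemma diff_op_ord_lt: "(\<And>i. x i \<in> carrier R) \<Longrightarrow> diff_op n x \<in> ord_lt n"
  by (induction n) (auto simp: closed)

lemma diff_op_closed: "(\<And>i. x i \<in> carrier R) \<Longrightarrow> diff_op n x \<in> carrier E"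
  by (rule ord_lt_closed[OF diff_op_ord_lt])

lemma diff_op_cong: "(\<And>i. i < n \<Longrightarrow> x i = y i) \<Longrightarrow> diff_op n x = diff_op n y"
  by (induction n) auto

lemma ord_lt_diff_op:
  assumes "f \<in> ord_lt n"
  obtains x where "\<And>i. x i \<in> carrier R" "f = diff_op n x"
proof -
  have "\<exists>x. (\<forall>i. x i \<in> carrier R) \<and> f = diff_op n x"
    using assms
  proof (induction n arbitrary: f)
    case 0
    then show ?case by (intro exI[of _ "\<lambda>_. \<zero>\<^bsub>R\<^esub>"]) simp
  next
    case (Suc n)
    obtain g r where g: "g \<in> ord_lt n" "r \<in> carrier R" "f = g \<oplus> \<iota> r \<otimes> \<delta> [^] n"
      using Suc.prems by (rule ord_lt_SucE)
    obtain x where x: "\<And>i. x i \<in> carrier R" "g = diff_op n x" using Suc.IH[OF g(1)] by blast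
    have "diff_op n (x(n := r)) = diff_op n x" by (rule diff_op_cong) simp
    with g(3) x(2) have "f = diff_op (Suc n) (x(n := r))" by simp
    moreover have "\<forall>i. (x(n := r)) i \<in> carrier R" using g(2) x(1) by simp
    ultimately show ?case by blast
  qed
  then show thesis using that by blast
qed

lemma diff_op_add:
  assumes "\<And>i. x i \<in> carrier R" "\<And>i. y i \<in> carrier R"
  shows "diff_op n (\<lambda>i. x i \<oplus>\<^bsub>R\<^esub> y i) = diff_op n x \<oplus> diff_op n y"
  using assms by (induction n)
    (simp_all add: left_mult_add closed diff_op_closed E.l_distr E.a_ac)

lemma diff_op_left_mult:
  assumes "\<And>i. x i \<in> carrier R" "r \<in> carrier R"
  shows "diff_op n (\<lambda>i. r \<otimes>\<^bsub>R\<^esub> x i) = \<iota> r \<otimes> diff_op n x"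
  using assms by (induction n)
    (simp_all add: left_mult_mult closed diff_op_closed E.r_distr E.m_assoc)

lemma diff_op_zero: "diff_op n (\<lambda>_. \<zero>\<^bsub>R\<^esub>) = \<zero>"
  by (induction n) (simp_all add: left_mult_zero closed)

lemma diff_op_single:
  assumes "u \<in> carrier R" "j < n"
  shows "diff_op n (\<lambda>i. if i = j then u else \<zero>\<^bsub>R\<^esub>) = \<iota> u \<otimes> \<delta> [^] j"
  using assms(2)
proof (induction n)
  case (Suc n)
  show ?case
  proof (cases "n = j")
    case True
    have "diff_op n (\<lambda>i. if i = j then u else \<zero>\<^bsub>R\<^esub>) = diff_op n (\<lambda>_. \<zero>\<^bsub>R\<^esub>)"
      using True by (intro diff_op_cong) simp
    then show ?thesis using True assms(1) by (simp add: diff_op_zero closed)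
  next
    case False
    then show ?thesis using Suc assms(1) by (simp add: left_mult_zero closed)
  qed
qed simp

text \<open>Effect on coefficients of right multiplication by \<open>\<delta>\<close>.\<close>
definition shift :: "(nat \<Rightarrow> 'r) \<Rightarrow> nat \<Rightarrow> 'r" where
  "shift x = case_nat \<zero>\<^bsub>R\<^esub> x"

lemma shift_closed: "(\<And>i. x i \<in> carrier R) \<Longrightarrow> shift x i \<in> carrier R"
  by (simp add: shift_def split: nat.split)

lemma diff_op_mult_delta:
  assumes "\<And>i. x i \<in> carrier R"
  shows "diff_op n x \<otimes> \<delta> = diff_op (Suc n) (shift x)"
proof (induction n)
  case 0
  show ?case by (simp add: shift_def left_mult_zero closed)
next
  case (Suc n)
  have "diff_op (Suc n) x \<otimes> \<delta> = diff_op n x \<otimes> \<delta> \<oplus> \<iota> (x n) \<otimes> \<delta> [^] Suc n"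
    using assms by (simp add: closed diff_op_closed E.l_distr E.m_assoc)
  then show ?case unfolding Suc by (simp add: shift_def)
qed

lemma delta_mult_diff_op:
  assumes "\<And>i. x i \<in> carrier R"
  shows "\<delta> \<otimes> diff_op n x = diff_op n (\<lambda>i. \<delta> (x i)) \<oplus> diff_op n x \<otimes> \<delta>"
proof (induction n)
  case 0
  show ?case by (simp add: closed)
next
  case (Suc n)
  have "\<delta> \<otimes> (\<iota> (x n) \<otimes> \<delta> [^] n) = \<iota> (\<delta> (x n)) \<otimes> \<delta> [^] n \<oplus> \<iota> (x n) \<otimes> \<delta> [^] n \<otimes> \<delta>"
  proof -
    have "\<delta> \<otimes> (\<iota> (x n) \<otimes> \<delta> [^] n) = (\<iota> (\<delta> (x n)) \<oplus> \<iota> (x n) \<otimes> \<delta>) \<otimes> \<delta> [^] n"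
      using assms by (simp add: closed E.m_assoc[symmetric] delta_left_mult)
    also have "\<dots> = \<iota> (\<delta> (x n)) \<otimes> \<delta> [^] n \<oplus> \<iota> (x n) \<otimes> (\<delta> \<otimes> \<delta> [^] n)"
      using assms by (simp add: closed E.l_distr E.m_assoc)
    also have "\<delta> \<otimes> \<delta> [^] n = \<delta> [^] n \<otimes> \<delta>"
      using E.nat_pow_Suc2[OF delta_in] by simp
    finally show ?thesis using assms by (simp add: closed E.m_assoc)
  qed
  then show ?case
    using Suc assms by (simp add: closed diff_op_closed E.r_distr E.l_distr E.a_ac)
qed

text \<open>Congruence modulo the left ideal \<open>D a\<close>; it is compatible with left multiplication only.\<close>
definition left_congruent :: "('r \<Rightarrow> 'r) \<Rightarrow> ('r \<Rightarrow> 'r) \<Rightarrow> ('r \<Rightarrow> 'r) \<Rightarrow> bool" where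
  "left_congruent a f g \<longleftrightarrow> (\<exists>c \<in> operators. f = g \<oplus> c \<otimes> a)"

lemma left_congruent_refl:
  "\<lbrakk> a \<in> carrier E; f \<in> carrier E \<rbrakk> \<Longrightarrow> left_congruent a f f"
  unfolding left_congruent_def by (intro bexI[of _ \<zero>]) (simp_all add: operators_zero)

lemma left_congruent_trans:
  assumes "left_congruent a f g" "left_congruent a g h" "a \<in> carrier E" "h \<in> carrier E"
  shows "left_congruent a f h"
proof -
  obtain c d where c: "c \<in> operators" "f = g \<oplus> c \<otimes> a" "d \<in> operators" "g = h \<oplus> d \<otimes> a"
    using assms(1,2) unfolding left_congruent_def by blast
  then have "f = h \<oplus> (d \<oplus> c) \<otimes> a"
    using assms(3,4) by (simp add: operators_closed E.l_distr E.a_assoc)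
  then show ?thesis using c operators_add unfolding left_congruent_def by blast
qed

lemma left_congruent_add:
  assumes "left_congruent a f g" "left_congruent a f' g'"
    and "a \<in> carrier E" "g \<in> carrier E" "g' \<in> carrier E"
  shows "left_congruent a (f \<oplus> f') (g \<oplus> g')"
proof -
  obtain c d where c: "c \<in> operators" "f = g \<oplus> c \<otimes> a" "d \<in> operators" "f' = g' \<oplus> d \<otimes> a"
    using assms(1,2) unfolding left_congruent_def by blast
  then have "f \<oplus> f' = (g \<oplus> g') \<oplus> (c \<oplus> d) \<otimes> a"
    using assms(3-) by (simp add: operators_closed E.l_distr E.a_ac)
  then show ?thesis using c operators_add unfolding left_congruent_def by blast
qed

lemma left_congruent_mult:
  assumes "left_congruent a f g" "d \<in> operators" "a \<in> carrier E" "g \<in> carrier E"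
  shows "left_congruent a (d \<otimes> f) (d \<otimes> g)"
proof -
  obtain c where c: "c \<in> operators" "f = g \<oplus> c \<otimes> a"
    using assms(1) unfolding left_congruent_def by blast
  then have "d \<otimes> f = d \<otimes> g \<oplus> (d \<otimes> c) \<otimes> a"
    using assms(2-) by (simp add: operators_closed E.r_distr E.m_assoc)
  then show ?thesis using c assms(2) operators_mult unfolding left_congruent_def by blast
qed

text \<open>Left multiplication by \<open>\<delta>\<close> on coordinates modulo \<open>a = \<delta>\<^sup>n + q\<close>: the entrywise derivation plus
  the companion matrix. The overflow \<open>x m \<delta>\<^sup>n\<close> is replaced by \<open>- x m q\<close>.\<close>
lemma delta_mult_diff_op_congruent:
  assumes q: "\<And>i. q i \<in> carrier R" and x: "\<And>i. x i \<in> carrier R"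
    and a: "a = diff_op (Suc m) q \<oplus> \<delta> [^] Suc m"
  shows "left_congruent a (\<delta> \<otimes> diff_op (Suc m) x)
    (diff_op (Suc m) (\<lambda>i. (\<delta> (x i) \<oplus>\<^bsub>R\<^esub> shift x i) \<oplus>\<^bsub>R\<^esub> (\<ominus>\<^bsub>R\<^esub> q i) \<otimes>\<^bsub>R\<^esub> x m))"
    (is "left_congruent a _ ?r")
proof -
  let ?n = "Suc m"
  note c = closed diff_op_closed shift_closed q x
  have "diff_op ?n (\<lambda>i. (\<ominus>\<^bsub>R\<^esub> q i) \<otimes>\<^bsub>R\<^esub> x m) = diff_op ?n (\<lambda>i. (\<ominus>\<^bsub>R\<^esub> x m) \<otimes>\<^bsub>R\<^esub> q i)"
    using q x by (intro diff_op_cong) (simp add: R.l_minus R.r_minus R.m_comm)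
  also have "\<dots> = \<iota> (\<ominus>\<^bsub>R\<^esub> x m) \<otimes> diff_op ?n q"
    using q x by (intro diff_op_left_mult) auto
  finally have r: "?r = (diff_op ?n (\<lambda>i. \<delta> (x i)) \<oplus> diff_op ?n (shift x)) \<oplus>
      \<ominus> \<iota> (x m) \<otimes> diff_op ?n q"
    using c by (simp add: diff_op_add left_mult_minus del: diff_op.simps)
  have "\<iota> (x m) \<otimes> a = \<iota> (x m) \<otimes> diff_op ?n q \<oplus> \<iota> (x m) \<otimes> \<delta> [^] ?n"
    unfolding a using c by (simp add: E.r_distr del: diff_op.simps E.nat_pow_Suc)
  then have "?r \<oplus> \<iota> (x m) \<otimes> a =
      diff_op ?n (\<lambda>i. \<delta> (x i)) \<oplus> (diff_op ?n (shift x) \<oplus> \<iota> (x m) \<otimes> \<delta> [^] ?n)"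
    unfolding r using c
    by (simp add: E.l_minus E.a_assoc E.r_neg1 del: diff_op.simps E.nat_pow_Suc)
  also have "diff_op ?n (shift x) \<oplus> \<iota> (x m) \<otimes> \<delta> [^] ?n = diff_op ?n x \<otimes> \<delta>"
    unfolding diff_op_mult_delta[OF x] by (simp add: shift_def)
  also have "diff_op ?n (\<lambda>i. \<delta> (x i)) \<oplus> diff_op ?n x \<otimes> \<delta> = \<delta> \<otimes> diff_op ?n x"
    by (rule delta_mult_diff_op[OF x, symmetric])
  finally show ?thesis unfolding left_congruent_def
    using x by (intro bexI[of _ "\<iota> (x m)"]) (simp_all add: operators_left_mult)
qed

text \<open>The \<open>j\<close>-th column of the matrix of operators through which \<open>\<delta>\<^sup>l\<close> acts on coordinates modulo
  \<open>D a\<close>: applied to \<open>u\<close>, it gives the coordinates of \<open>\<delta>\<^sup>l u \<delta>\<^sup>j\<close>. Each further factor \<open>\<delta>\<close> acts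
  entrywise and adds a companion matrix of order zero, so \<open>\<delta>\<^sup>l\<close> on the diagonal is the only term of order \<open>l\<close>.\<close>
lemma delta_pow_matrix:
  assumes q: "\<And>i. q i \<in> carrier R" and a: "a = diff_op (Suc m) q \<oplus> \<delta> [^] Suc m"
    and j: "j < Suc m"
  shows "\<exists>M. (\<forall>i. M i \<in> ord_lt l) \<and> (\<forall>u \<in> carrier R. left_congruent a
    (\<delta> [^] l \<otimes> (\<iota> u \<otimes> \<delta> [^] j))
    (diff_op (Suc m) (\<lambda>i. (M i \<oplus> (if i = j then \<delta> [^] l else \<zero>)) u)))"
proof -
  have ac: "a \<in> carrier E" unfolding a using q by (simp add: diff_op_closed closed del: diff_op.simps)
  show ?thesis
  proof (induction l)
    case 0
    show ?case
    proof (intro exI[of _ "\<lambda>_. \<zero>"] conjI allI ballI)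
      fix u assume u: "u \<in> carrier R"
      have "diff_op (Suc m) (\<lambda>i. (\<zero> \<oplus> (if i = j then \<delta> [^] (0::nat) else \<zero>)) u) =
          \<iota> u \<otimes> \<delta> [^] j"
        using diff_op_single[OF u j] u
        by (subst diff_op_cong[where y = "\<lambda>i. if i = j then u else \<zero>\<^bsub>R\<^esub>"])
          (auto simp: one_apply zero_apply)
      then show "left_congruent a (\<delta> [^] (0::nat) \<otimes> (\<iota> u \<otimes> \<delta> [^] j))
          (diff_op (Suc m) (\<lambda>i. (\<zero> \<oplus> (if i = j then \<delta> [^] (0::nat) else \<zero>)) u))"
        using u ac by (simp add: left_congruent_refl closed del: diff_op.simps)
    qed simp
  next
    case (Suc l)
    obtain M where M: "\<And>i. M i \<in> ord_lt l"
      and cong: "\<And>u. u \<in> carrier R \<Longrightarrow> left_congruent a (\<delta> [^] l \<otimes> (\<iota> u \<otimes> \<delta> [^] j))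
        (diff_op (Suc m) (\<lambda>i. (M i \<oplus> (if i = j then \<delta> [^] l else \<zero>)) u))"
      using Suc.IH by blast
    define L where "L i = M i \<oplus> (if i = j then \<delta> [^] l else \<zero>)" for i
    have L: "L i \<in> ord_lt (Suc l)" for i
      unfolding L_def using ord_lt_Suc[OF M] pow_ord_lt[of l] ord_lt_zero
      by (auto intro!: ord_lt_add simp del: ord_lt.simps)
    define M' where "M' i = (\<delta> \<otimes> M i \<oplus> case_nat \<zero> L i) \<oplus> \<iota> (\<ominus>\<^bsub>R\<^esub> q i) \<otimes> L m" for i
    have M': "M' i \<in> ord_lt (Suc l)" for i
    proof -
      have "case_nat \<zero> L i \<in> ord_lt (Suc l)"
        using L ord_lt_zero by (simp split: nat.split del: ord_lt.simps)
      then show ?thesis unfolding M'_def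
        using L q M by (intro ord_lt_add ord_lt_left_mult delta_mult_ord_lt) auto
    qed
    note Mc = ord_lt_closed[OF M] and Lc = ord_lt_closed[OF L]
    have powS: "\<delta> [^] Suc l = \<delta> \<otimes> \<delta> [^] l" by (rule E.nat_pow_Suc2[OF delta_in])
    have entry: "(M' i \<oplus> (if i = j then \<delta> [^] Suc l else \<zero>)) u =
        (\<delta> (L i u) \<oplus>\<^bsub>R\<^esub> shift (\<lambda>i. L i u) i) \<oplus>\<^bsub>R\<^esub> (\<ominus>\<^bsub>R\<^esub> q i) \<otimes>\<^bsub>R\<^esub> L m u"
      if u: "u \<in> carrier R" for i u
    proof -
      have cn: "case_nat \<zero> L i \<in> carrier E" using Lc by (simp split: nat.split)
      have "M' i \<oplus> (if i = j then \<delta> [^] Suc l else \<zero>) =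
          (\<delta> \<otimes> L i \<oplus> case_nat \<zero> L i) \<oplus> \<iota> (\<ominus>\<^bsub>R\<^esub> q i) \<otimes> L m"
        unfolding M'_def L_def[of i] powS using Mc[of i] Lc[of m] cn q
        by (simp add: closed E.r_distr E.a_ac)
      then show ?thesis
        using u Lc[of i] Lc[of m] cn q
        by (simp add: closed applies, simp add: shift_def applies split: nat.split)
    qed
    show ?case
    proof (intro exI[of _ M'] conjI allI ballI M')
      fix u assume u: "u \<in> carrier R"
      have Lu: "L i u \<in> carrier R" for i using u Lc by (simp add: closed)
      have dc: "\<delta> [^] Suc l \<otimes> (\<iota> u \<otimes> \<delta> [^] j) = \<delta> \<otimes> (\<delta> [^] l \<otimes> (\<iota> u \<otimes> \<delta> [^] j))"
        unfolding powS using u by (simp add: closed E.m_assoc)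
      have "left_congruent a (\<delta> [^] Suc l \<otimes> (\<iota> u \<otimes> \<delta> [^] j))
          (\<delta> \<otimes> diff_op (Suc m) (\<lambda>i. L i u))"
        unfolding dc using cong[OF u] ac Lu
        by (intro left_congruent_mult) (simp_all add: L_def operators_delta diff_op_closed
            del: diff_op.simps)
      moreover have "left_congruent a (\<delta> \<otimes> diff_op (Suc m) (\<lambda>i. L i u)) (diff_op (Suc m)
          (\<lambda>i. (M' i \<oplus> (if i = j then \<delta> [^] Suc l else \<zero>)) u))"
        unfolding entry[OF u] by (rule delta_mult_diff_op_congruent[OF q Lu a])
      moreover have "diff_op (Suc m) (\<lambda>i. (M' i \<oplus> (if i = j then \<delta> [^] Suc l else \<zero>)) u)
          \<in> carrier E"
        using ord_lt_closed[OF M'] u by (intro diff_op_closed) (simp add: closed)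
      ultimately show "left_congruent a (\<delta> [^] Suc l \<otimes> (\<iota> u \<otimes> \<delta> [^] j))
          (diff_op (Suc m) (\<lambda>i. (M' i \<oplus> (if i = j then \<delta> [^] Suc l else \<zero>)) u))"
        using left_congruent_trans ac by blast
    qed
  qed
qed

text \<open>The same for an arbitrary operator, where only the bound on the order of the entries is kept. It is
  applied to the lower-order part of the modulus \<open>a\<close> itself.\<close>
lemma operator_matrix:
  assumes q: "\<And>i. q i \<in> carrier R" and a: "a = diff_op (Suc m) q \<oplus> \<delta> [^] Suc m"
    and j: "j < Suc m" and f: "f \<in> ord_lt l"
  shows "\<exists>M. (\<forall>i. M i \<in> ord_lt l) \<and> (\<forall>u \<in> carrier R. left_congruent a
    (f \<otimes> (\<iota> u \<otimes> \<delta> [^] j)) (diff_op (Suc m) (\<lambda>i. M i u)))"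
  using f
proof (induction l arbitrary: f)
  case 0
  have ac: "a \<in> carrier E" unfolding a using q by (simp add: diff_op_closed closed del: diff_op.simps)
  have "diff_op (Suc m) (\<lambda>i. \<zero> u) = \<zero>" if "u \<in> carrier R" for u
    using that diff_op_zero by (simp add: zero_apply del: diff_op.simps)
  then show ?case using 0 ac
    by (intro exI[of _ "\<lambda>_. \<zero>"]) (simp add: left_congruent_refl closed del: diff_op.simps)
next
  case (Suc l)
  have ac: "a \<in> carrier E" unfolding a using q by (simp add: diff_op_closed closed del: diff_op.simps)
  obtain g r where g: "g \<in> ord_lt l" "r \<in> carrier R" "f = g \<oplus> \<iota> r \<otimes> \<delta> [^] l"
    using Suc.prems by (rule ord_lt_SucE)
  obtain M where M: "\<And>i. M i \<in> ord_lt l"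
    and Mcong: "\<And>u. u \<in> carrier R \<Longrightarrow> left_congruent a
      (g \<otimes> (\<iota> u \<otimes> \<delta> [^] j)) (diff_op (Suc m) (\<lambda>i. M i u))"
    using Suc.IH[OF g(1)] by blast
  obtain N where N: "\<And>i. N i \<in> ord_lt l"
    and Ncong: "\<And>u. u \<in> carrier R \<Longrightarrow> left_congruent a (\<delta> [^] l \<otimes> (\<iota> u \<otimes> \<delta> [^] j))
      (diff_op (Suc m) (\<lambda>i. (N i \<oplus> (if i = j then \<delta> [^] l else \<zero>)) u))"
    using delta_pow_matrix[OF q a j, of l] by blast
  define L where "L i = N i \<oplus> (if i = j then \<delta> [^] l else \<zero>)" for i
  have L: "L i \<in> ord_lt (Suc l)" for i
    unfolding L_def using ord_lt_Suc[OF N] pow_ord_lt[of l] ord_lt_zero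
    by (auto intro!: ord_lt_add simp del: ord_lt.simps)
  note Mc = ord_lt_closed[OF M] and Lc = ord_lt_closed[OF L] and gc = ord_lt_closed[OF g(1)]
  show ?case
  proof (intro exI[of _ "\<lambda>i. M i \<oplus> \<iota> r \<otimes> L i"] conjI allI ballI)
    show "M i \<oplus> \<iota> r \<otimes> L i \<in> ord_lt (Suc l)" for i
      using ord_lt_Suc[OF M] L g(2) by (intro ord_lt_add ord_lt_left_mult)
    fix u assume u: "u \<in> carrier R"
    have "diff_op (Suc m) (\<lambda>i. (M i \<oplus> \<iota> r \<otimes> L i) u) =
        diff_op (Suc m) (\<lambda>i. M i u \<oplus>\<^bsub>R\<^esub> r \<otimes>\<^bsub>R\<^esub> L i u)"
      using u g(2) Mc Lc by (simp add: closed applies del: diff_op.simps)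
    also have "\<dots> = diff_op (Suc m) (\<lambda>i. M i u) \<oplus> \<iota> r \<otimes> diff_op (Suc m) (\<lambda>i. L i u)"
      using u g(2) Mc Lc
      by (simp add: diff_op_add diff_op_left_mult closed del: diff_op.simps)
    finally have eq: "diff_op (Suc m) (\<lambda>i. (M i \<oplus> \<iota> r \<otimes> L i) u) =
        diff_op (Suc m) (\<lambda>i. M i u) \<oplus> \<iota> r \<otimes> diff_op (Suc m) (\<lambda>i. L i u)" .
    have f: "f \<otimes> (\<iota> u \<otimes> \<delta> [^] j) =
        g \<otimes> (\<iota> u \<otimes> \<delta> [^] j) \<oplus> \<iota> r \<otimes> (\<delta> [^] l \<otimes> (\<iota> u \<otimes> \<delta> [^] j))"
      using u g gc by (simp add: closed E.l_distr E.m_assoc)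
    show "left_congruent a (f \<otimes> (\<iota> u \<otimes> \<delta> [^] j)) (diff_op (Suc m) (\<lambda>i. (M i \<oplus> \<iota> r \<otimes> L i) u))"
      unfolding eq f using Mcong[OF u] Ncong[OF u] u g(2) ac Mc Lc
      by (intro left_congruent_add left_congruent_mult)
        (simp_all add: L_def[symmetric] operators_left_mult diff_op_closed closed
          del: diff_op.simps)
  qed
qed

end

context surjective_operator_ring
begin

text \<open>Writing the unknown as \<open>b = \<Sum> Y\<^sub>j \<delta>\<^sup>j\<close> with \<open>j < n\<close> and comparing coordinates modulo \<open>D a\<close> turns
  \<open>a b \<equiv> v\<close> into a system whose matrix has \<open>\<delta>\<^sup>n\<close> on the diagonal up to lower order. Products
  \<open>a b\<close> are not linear over \<open>R\<close> in the coefficients of \<open>b\<close>, which is why the matrix entries are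
  operators and not elements of \<open>R\<close>.\<close>
lemma monic_left_congruence_solvable:
  assumes q: "\<And>i. q i \<in> carrier R" and a: "a = diff_op n q \<oplus> \<delta> [^] n"
    and v: "v \<in> carrier R"
  shows "\<exists>b \<in> operators. left_congruent a (a \<otimes> b) (\<iota> v)"
proof (cases n)
  case 0
  then have "a = \<one>" using a by simp
  then show ?thesis using v
    by (intro bexI[of _ "\<iota> v"]) (simp_all add: operators_left_mult left_congruent_refl closed)
next
  case (Suc m)
  note a' = a[unfolded Suc]
  have qo: "diff_op n q \<in> ord_lt n" using q by (rule diff_op_ord_lt)
  have ao: "a \<in> operators"
    unfolding a using ord_lt_operators[OF qo] by (simp add: operators_intros)
  have ac: "a \<in> carrier E" by (rule operators_closed[OF ao])
  define represents where "represents j M \<longleftrightarrow> (\<forall>i. M i \<in> ord_lt n) \<and>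
      (\<forall>u \<in> carrier R. left_congruent a (a \<otimes> (\<iota> u \<otimes> \<delta> [^] j))
        (diff_op n (\<lambda>i. (M i \<oplus> (if i = j then \<delta> [^] n else \<zero>)) u)))"
    for j :: nat and M :: "nat \<Rightarrow> 'r \<Rightarrow> 'r"
  have "\<exists>M. represents j M" if j: "j < n" for j
  proof -
    obtain N where N: "\<And>i. N i \<in> ord_lt n"
      and Ncong: "\<And>u. u \<in> carrier R \<Longrightarrow> left_congruent a
        (diff_op n q \<otimes> (\<iota> u \<otimes> \<delta> [^] j)) (diff_op n (\<lambda>i. N i u))"
      using operator_matrix[OF q a' j[unfolded Suc] qo] unfolding Suc by blast
    obtain P where P: "\<And>i. P i \<in> ord_lt n"
      and Pcong: "\<And>u. u \<in> carrier R \<Longrightarrow> left_congruent a (\<delta> [^] n \<otimes> (\<iota> u \<otimes> \<delta> [^] j))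
        (diff_op n (\<lambda>i. (P i \<oplus> (if i = j then \<delta> [^] n else \<zero>)) u))"
      using delta_pow_matrix[OF q a' j[unfolded Suc], of n] unfolding Suc by blast
    note Nc = ord_lt_closed[OF N] and Pc = ord_lt_closed[OF P]
    define L where "L i = P i \<oplus> (if i = j then \<delta> [^] n else \<zero>)" for i
    have Lc: "L i \<in> carrier E" for i unfolding L_def using Pc delta_in by simp
    show ?thesis
      unfolding represents_def
    proof (intro exI[of _ "\<lambda>i. N i \<oplus> P i"] conjI allI ballI)
      show "N i \<oplus> P i \<in> ord_lt n" for i using N P by (rule ord_lt_add)
      fix u assume u: "u \<in> carrier R"
      have "(N i \<oplus> P i) \<oplus> (if i = j then \<delta> [^] n else \<zero>) = N i \<oplus> L i" for i
        unfolding L_def using Nc Pc delta_in by (simp add: E.a_assoc)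
      then have eq: "diff_op n (\<lambda>i. ((N i \<oplus> P i) \<oplus> (if i = j then \<delta> [^] n else \<zero>)) u) =
          diff_op n (\<lambda>i. N i u) \<oplus> diff_op n (\<lambda>i. L i u)"
        using u Nc Lc by (simp add: add_apply diff_op_add closed)
      have split: "a \<otimes> (\<iota> u \<otimes> \<delta> [^] j) =
          diff_op n q \<otimes> (\<iota> u \<otimes> \<delta> [^] j) \<oplus> \<delta> [^] n \<otimes> (\<iota> u \<otimes> \<delta> [^] j)"
        unfolding a using u ord_lt_closed[OF qo] by (simp add: closed E.l_distr)
      show "left_congruent a (a \<otimes> (\<iota> u \<otimes> \<delta> [^] j))
          (diff_op n (\<lambda>i. ((N i \<oplus> P i) \<oplus> (if i = j then \<delta> [^] n else \<zero>)) u))"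
        unfolding eq split using Ncong[OF u] Pcong[OF u] u ac Nc Lc
        by (intro left_congruent_add) (simp_all add: L_def[symmetric] diff_op_closed closed)
    qed
  qed
  then obtain N where rep: "\<And>j. j < n \<Longrightarrow> represents j (N j)" by metis
  have N: "N j i \<in> ord_lt n" if "j < n" for i j
    using rep[OF that] by (simp add: represents_def)
  have Ncong: "left_congruent a (a \<otimes> (\<iota> u \<otimes> \<delta> [^] j))
      (diff_op n (\<lambda>i. (N j i \<oplus> (if i = j then \<delta> [^] n else \<zero>)) u))"
    if "j < n" "u \<in> carrier R" for j u
    using rep[OF that(1)] that(2) by (simp add: represents_def)
  \<comment> \<open>The columns are known for \<open>j < n\<close> only; zeros elsewhere make the bounds on the entries unconditional.\<close>
  define M where "M i j = (if j < n then N j i else \<zero>)" for i j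
  define L where "L i j = M i j \<oplus> (if i = j then \<delta> [^] n else \<zero>)" for i j
  have M: "M i j \<in> ord_lt n" for i j using N ord_lt_zero by (simp add: M_def)
  have Lc: "L i j \<in> carrier E" for i j
    unfolding L_def using ord_lt_closed[OF M] delta_in by simp
  have Lcong: "left_congruent a (a \<otimes> (\<iota> u \<otimes> \<delta> [^] j)) (diff_op n (\<lambda>i. L i j u))"
    if "j < n" "u \<in> carrier R" for j u
    using Ncong[OF that] that by (simp add: L_def M_def)
  define B where "B i = (if i = 0 then v else \<zero>\<^bsub>R\<^esub>)" for i :: nat
  have B: "B i \<in> carrier R" for i using v by (simp add: B_def)
  obtain Y where Y: "Y \<in> UNIV \<rightarrow> carrier R"
    "\<forall>i<n. (\<Oplus>\<^bsub>R\<^esub>j\<in>{..<n}. L i j (Y j)) = B i"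
    using monic_system_solvable[OF L_def M B, of n] by (rule bexE)
  have Yc: "Y j \<in> carrier R" for j using Y(1) by auto
  have Sc: "(\<Oplus>\<^bsub>R\<^esub>j\<in>{..<k}. L i j (Y j)) \<in> carrier R" for i k :: nat
    using Lc Yc by (intro R.finsum_closed) (simp add: closed)
  have "left_congruent a (a \<otimes> diff_op k Y) (diff_op n (\<lambda>i. \<Oplus>\<^bsub>R\<^esub>j\<in>{..<k}. L i j (Y j)))"
    if "k \<le> n" for k
    using that
  proof (induction k)
    case 0
    then show ?case using ac by (simp add: left_congruent_refl diff_op_zero)
  next
    case (Suc k)
    have "(\<Oplus>\<^bsub>R\<^esub>j\<in>{..<Suc k}. L i j (Y j)) =
        (\<Oplus>\<^bsub>R\<^esub>j\<in>{..<k}. L i j (Y j)) \<oplus>\<^bsub>R\<^esub> L i k (Y k)" for i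
      unfolding lessThan_Suc using Lc Yc Sc
      by (subst R.finsum_insert) (simp_all add: closed R.a_comm)
    then have eq: "diff_op n (\<lambda>i. \<Oplus>\<^bsub>R\<^esub>j\<in>{..<Suc k}. L i j (Y j)) =
        diff_op n (\<lambda>i. \<Oplus>\<^bsub>R\<^esub>j\<in>{..<k}. L i j (Y j)) \<oplus> diff_op n (\<lambda>i. L i k (Y k))"
      using Sc Lc Yc by (simp add: diff_op_add closed)
    have split: "a \<otimes> diff_op (Suc k) Y = a \<otimes> diff_op k Y \<oplus> a \<otimes> (\<iota> (Y k) \<otimes> \<delta> [^] k)"
      using Yc ac by (simp add: E.r_distr closed diff_op_closed)
    show ?case unfolding eq split
      using Suc Lcong[of k "Y k"] Sc Lc Yc ac
      by (intro left_congruent_add) (simp_all add: diff_op_closed closed)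
  qed
  from this[of n] have "left_congruent a (a \<otimes> diff_op n Y)
      (diff_op n (\<lambda>i. \<Oplus>\<^bsub>R\<^esub>j\<in>{..<n}. L i j (Y j)))" by simp
  also have "diff_op n (\<lambda>i. \<Oplus>\<^bsub>R\<^esub>j\<in>{..<n}. L i j (Y j)) =
      diff_op n (\<lambda>i. if i = 0 then v else \<zero>\<^bsub>R\<^esub>)"
    using Y(2) by (intro diff_op_cong) (simp add: B_def)
  also have "\<dots> = \<iota> v"
    using diff_op_single[OF v, of 0 n] v by (simp add: Suc closed del: diff_op.simps)
  finally show ?thesis
    by (rule bexI[OF _ ord_lt_operators[OF diff_op_ord_lt]]) (rule Yc)
qed

text \<open>The modulus is made monic by a left factor \<open>s = r\<^sup>-\<^sup>1\<close>. Asking for the residue \<open>s\<close> instead of \<open>1\<close> compensates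
  for it: a plain conjugation would leave a factor to the right of \<open>a\<close>.\<close>
lemma one_decomposition:
  assumes a: "a \<in> operators" "a \<noteq> \<zero>"
  shows "\<exists>b \<in> operators. \<exists>c \<in> operators. \<one> = a \<otimes> b \<oplus> c \<otimes> a"
proof -
  define n where "n = (LEAST n. a \<in> ord_lt n)"
  have n: "a \<in> ord_lt n" unfolding n_def using a(1) by (auto elim: operatorsE intro: LeastI)
  have "n \<noteq> 0" using n a(2) by (cases n) auto
  then obtain k where k: "n = Suc k" by (cases n) auto
  then have not: "a \<notin> ord_lt k" using not_less_Least[of k "\<lambda>n. a \<in> ord_lt n"] n_def by simp
  obtain f r where f: "f \<in> ord_lt k" "r \<in> carrier R" "a = f \<oplus> \<iota> r \<otimes> \<delta> [^] k"
    using n unfolding k by (rule ord_lt_SucE)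
  have "r \<noteq> \<zero>\<^bsub>R\<^esub>"
    using f not by (auto simp: left_mult_zero ord_lt_closed closed)
  then have r: "r \<in> Units R" using f R.field_Units by blast
  define s where "s = inv\<^bsub>R\<^esub> r"
  have s: "s \<in> carrier R" "s \<otimes>\<^bsub>R\<^esub> r = \<one>\<^bsub>R\<^esub>" "r \<otimes>\<^bsub>R\<^esub> s = \<one>\<^bsub>R\<^esub>" using r by (simp_all add: s_def)
  obtain q where q: "\<And>i. q i \<in> carrier R" "\<iota> s \<otimes> f = diff_op k q"
    using ord_lt_diff_op[OF ord_lt_left_mult[OF s(1) f(1)]] by blast
  have inv: "\<iota> s \<otimes> \<iota> r = \<one>" "\<iota> r \<otimes> \<iota> s = \<one>"
    using s f by (simp_all add: left_mult_mult[symmetric] left_mult_one)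
  have ac: "a \<in> carrier E" by (rule operators_closed[OF a(1)])
  define a' where "a' = \<iota> s \<otimes> a"
  have "a' = diff_op k q \<oplus> (\<iota> s \<otimes> \<iota> r) \<otimes> \<delta> [^] k"
    unfolding a'_def f(3) q(2)[symmetric] using s f ord_lt_closed[OF f(1)]
    by (simp add: E.r_distr E.m_assoc closed)
  then have a': "a' = diff_op k q \<oplus> \<delta> [^] k" by (simp add: inv closed)
  obtain b c where bc: "b \<in> operators" "c \<in> operators" "a' \<otimes> b = \<iota> s \<oplus> c \<otimes> a'"
    using monic_left_congruence_solvable[OF q(1) a' s(1)] unfolding left_congruent_def by blast
  note cc = operators_closed[OF bc(1)] operators_closed[OF bc(2)] s(1) f(2) ac
  have "\<iota> r \<otimes> (a' \<otimes> b) = (\<iota> r \<otimes> \<iota> s) \<otimes> (a \<otimes> b)"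
    unfolding a'_def using cc by (simp add: closed E.m_assoc)
  then have "a \<otimes> b = \<iota> r \<otimes> (a' \<otimes> b)" using cc by (simp add: inv)
  also have "\<dots> = \<one> \<oplus> (\<iota> r \<otimes> c \<otimes> \<iota> s) \<otimes> a"
    unfolding bc(3) unfolding a'_def using cc inv by (simp add: closed E.m_assoc E.r_distr)
  finally have ab: "a \<otimes> b = \<one> \<oplus> (\<iota> r \<otimes> c \<otimes> \<iota> s) \<otimes> a" .
  have "\<one> = a \<otimes> b \<oplus> (\<ominus> (\<iota> r \<otimes> c \<otimes> \<iota> s)) \<otimes> a"
    unfolding ab using cc by (simp add: closed E.l_minus E.a_assoc E.r_neg)
  moreover have "\<ominus> (\<iota> r \<otimes> c \<otimes> \<iota> s) \<in> operators"
    using bc s f by (simp add: operators_intros)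
  ultimately show ?thesis using bc(1) by blast
qed

end

section \<open>The algebra of differential operators\<close>

lemma End_algebra_sel:
  "carrier (End_algebra K M) = linear_endos K M"
  "mult (End_algebra K M) = compose (carrier M)"
  "one (End_algebra K M) = (\<lambda>x \<in> carrier M. x)"
  "zero (End_algebra K M) = (\<lambda>x \<in> carrier M. \<zero>\<^bsub>M\<^esub>)"
  "add (End_algebra K M) = (\<lambda>f g. \<lambda>x \<in> carrier M. f x \<oplus>\<^bsub>M\<^esub> g x)"
  "smult (End_algebra K M) = (\<lambda>c f. \<lambda>x \<in> carrier M. c \<odot>\<^bsub>M\<^esub> f x)"
  by (simp_all add: End_algebra_def)

context module
begin

lemma linear_endosI:
  assumes "\<And>x. x \<in> carrier M \<Longrightarrow> f x \<in> carrier M"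
    and "\<And>x y. \<lbrakk> x \<in> carrier M; y \<in> carrier M \<rbrakk> \<Longrightarrow> f (x \<oplus>\<^bsub>M\<^esub> y) = f x \<oplus>\<^bsub>M\<^esub> f y"
    and "\<And>c x. \<lbrakk> c \<in> carrier R; x \<in> carrier M \<rbrakk> \<Longrightarrow> f (c \<odot>\<^bsub>M\<^esub> x) = c \<odot>\<^bsub>M\<^esub> f x"
  shows "(\<lambda>x \<in> carrier M. f x) \<in> linear_endos R M"
  using assms by (simp add: linear_endos_def)

lemma linear_endosD:
  assumes "f \<in> linear_endos R M"
  shows "x \<in> carrier M \<Longrightarrow> f x \<in> carrier M"
    and "\<lbrakk> x \<in> carrier M; y \<in> carrier M \<rbrakk> \<Longrightarrow> f (x \<oplus>\<^bsub>M\<^esub> y) = f x \<oplus>\<^bsub>M\<^esub> f y"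
    and "\<lbrakk> c \<in> carrier R; x \<in> carrier M \<rbrakk> \<Longrightarrow> f (c \<odot>\<^bsub>M\<^esub> x) = c \<odot>\<^bsub>M\<^esub> f x"
  using assms by (auto simp: linear_endos_def)

lemma linear_endos_eqI:
  assumes "f \<in> linear_endos R M" "g \<in> linear_endos R M" "\<And>x. x \<in> carrier M \<Longrightarrow> f x = g x"
  shows "f = g"
  using assms by (intro extensionalityI[of f "carrier M" g]) (auto simp: linear_endos_def PiE_def)

lemma End_algebra_ring: "ring (End_algebra R M)"
proof -
  note D = linear_endosD
  have add: "(\<lambda>x \<in> carrier M. f x \<oplus>\<^bsub>M\<^esub> g x) \<in> linear_endos R M"
    if "f \<in> linear_endos R M" "g \<in> linear_endos R M" for f g
    by (rule linear_endosI) (simp_all add: D[OF that(1)] D[OF that(2)] M.a_ac smult_r_distr)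
  have neg: "(\<lambda>x \<in> carrier M. \<ominus>\<^bsub>M\<^esub> f x) \<in> linear_endos R M"
    if "f \<in> linear_endos R M" for f
    by (rule linear_endosI) (simp_all add: D[OF that] M.minus_add smult_r_minus)
  have zero: "(\<lambda>x \<in> carrier M. \<zero>\<^bsub>M\<^esub>) \<in> linear_endos R M"
    by (rule linear_endosI) simp_all
  have one: "(\<lambda>x \<in> carrier M. x) \<in> linear_endos R M"
    by (rule linear_endosI) simp_all
  have comp: "compose (carrier M) f g \<in> linear_endos R M"
    if "f \<in> linear_endos R M" "g \<in> linear_endos R M" for f g
    unfolding compose_def by (rule linear_endosI) (simp_all add: D[OF that(1)] D[OF that(2)])
  show ?thesis
  proof (rule ringI)
    show "abelian_group (End_algebra R M)"
    proof (rule abelian_groupI; unfold End_algebra_sel)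
      fix f assume f: "f \<in> linear_endos R M"
      show "\<exists>g \<in> linear_endos R M. (\<lambda>x \<in> carrier M. g x \<oplus>\<^bsub>M\<^esub> f x) = (\<lambda>x \<in> carrier M. \<zero>\<^bsub>M\<^esub>)"
        by (rule bexI[OF _ neg[OF f]], rule restrict_ext) (simp add: M.l_neg D(1)[OF f])
    qed (auto intro!: add zero linear_endos_eqI simp: D M.a_ac restrict_apply' simp del: restrict_apply)
    show "monoid (End_algebra R M)"
      by (rule monoidI; unfold End_algebra_sel)
        (auto intro!: comp one linear_endos_eqI simp: D compose_eq restrict_apply' simp del: restrict_apply)
  qed (unfold End_algebra_sel,
      auto intro!: comp add linear_endos_eqI simp: D compose_eq restrict_apply' simp del: restrict_apply)
qed

end

context differential_algebra
begin

lemma left_mult_linear_endo: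
  assumes "r \<in> carrier R"
  shows "left_mult R r \<in> linear_endos K R"
  unfolding left_mult_def using assms
  by (intro linear_endosI) (simp_all add: A.r_distr smult_mult_right)

lemma operator_ring_End_algebra:
  assumes "cring R"
  shows "operator_ring (End_algebra K R) R \<delta>"
proof -
  interpret E: ring "End_algebra K R" by (rule End_algebra_ring)
  interpret C: cring R by fact
  note D = linear_endosD
  show ?thesis
    by unfold_locales
      (use derivation_linear left_mult_linear_endo leibniz in
        \<open>auto simp: End_algebra_sel compose_def D intro: linear_endos_eqI\<close>)
qed

text \<open>Closure under scalars is automatic for the operators of finite order, because \<open>c f\<close> is the
  product of multiplication by \<open>c 1\<close> with \<open>f\<close>.\<close>
lemma carrier_differential_operators:
  assumes "cring R"
  shows "carrier (differential_operators K R \<delta>) =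
    operator_ring.operators (End_algebra K R) R \<delta>"
proof -
  interpret operator_ring "End_algebra K R" R \<delta>
    using assms by (rule operator_ring_End_algebra)
  let ?E = "End_algebra K R"
  let ?gen = "insert \<delta> (left_mult R ` carrier R)"
  have "submodule operators K ?E"
  proof
    show "operators \<subseteq> carrier (add_monoid ?E)" using operators_closed by auto
    show "x \<otimes>\<^bsub>add_monoid ?E\<^esub> y \<in> operators" if "x \<in> operators" "y \<in> operators" for x y
      using operators_add[OF that] by simp
    show "\<one>\<^bsub>add_monoid ?E\<^esub> \<in> operators" using operators_zero by simp
    show "inv\<^bsub>add_monoid ?E\<^esub> x \<in> operators" if "x \<in> operators" for x
      using operators_minus[OF that] by (simp add: a_inv_def)
  next
    fix c f assume c: "c \<in> carrier K" and f: "f \<in> operators"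
    have fl: "f \<in> linear_endos K R" using operators_closed[OF f] by (simp add: End_algebra_sel)
    have cl: "c \<odot>\<^bsub>R\<^esub> \<one>\<^bsub>R\<^esub> \<in> carrier R" using c by simp
    have "c \<odot>\<^bsub>?E\<^esub> f = left_mult R (c \<odot>\<^bsub>R\<^esub> \<one>\<^bsub>R\<^esub>) \<otimes>\<^bsub>?E\<^esub> f"
      unfolding End_algebra_sel compose_def left_mult_def
    proof (rule restrict_ext)
      fix x assume "x \<in> carrier R"
      then have fx: "f x \<in> carrier R" by (rule linear_endosD(1)[OF fl])
      then have "(c \<odot>\<^bsub>R\<^esub> \<one>\<^bsub>R\<^esub>) \<otimes>\<^bsub>R\<^esub> f x = c \<odot>\<^bsub>R\<^esub> f x"
        using c smult_mult_left[of c "\<one>\<^bsub>R\<^esub>" "f x"] by simp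
      then show "c \<odot>\<^bsub>R\<^esub> f x = (\<lambda>y \<in> carrier R. (c \<odot>\<^bsub>R\<^esub> \<one>\<^bsub>R\<^esub>) \<otimes>\<^bsub>R\<^esub> y) (f x)"
        using fx by simp
    qed
    then show "c \<odot>\<^bsub>?E\<^esub> f \<in> operators"
      using operators_mult[OF operators_left_mult[OF cl] f] by simp
  qed
  then have "generated_subalgebra K ?E ?gen \<subseteq> operators"
    unfolding generated_subalgebra_def
    using operators_subring operators_delta operators_left_mult by (intro Inter_lower) auto
  moreover have "operators \<subseteq> generated_subalgebra K ?E ?gen"
    unfolding generated_subalgebra_def
  proof (intro Inter_greatest)
    fix S assume "S \<in> {S. subring S ?E \<and> submodule S K ?E \<and> ?gen \<subseteq> S}"
    then show "operators \<subseteq> S" by (intro operators_least) auto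
  qed
  ultimately show ?thesis by (simp add: differential_operators_def)
qed

end

theorem theorem6:
  fixes K :: "('k, 'u) ring_scheme"
    and R :: "('k, 'r, 'v) module_scheme"
    and \<delta> :: "'r \<Rightarrow> 'r"
  assumes "differential_algebra K R \<delta>"
    and "cring R"
  shows "weakly_fadelian (differential_operators K R \<delta>) \<longleftrightarrow>
    field R \<and>
    (\<forall>f \<in> carrier (differential_operators K R \<delta>).
      f \<noteq> \<zero>\<^bsub>differential_operators K R \<delta>\<^esub> \<longrightarrow> f ` carrier R = carrier R)"
    (is "?wf \<longleftrightarrow> field R \<and> ?surj")
proof -
  let ?D = "differential_operators K R \<delta>"
  let ?E = "End_algebra K R"
  interpret dalg: differential_algebra K R \<delta> by fact
  interpret operator_ring ?E R \<delta> using assms(2) by (rule dalg.operator_ring_End_algebra)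
  have carrier_D: "carrier ?D = operators"
    using assms(2) by (rule dalg.carrier_differential_operators)
  have D_sel: "mult ?D = mult ?E" "one ?D = one ?E" "zero ?D = zero ?E" "add ?D = add ?E"
    by (simp_all add: differential_operators_def)
  show ?thesis
  proof
    assume ?wf
    then interpret W: weakly_fadelian ?D .
    \<comment> \<open>The relation for \<open>f \<delta>\<close>, evaluated at \<open>1\<close>, where \<open>c (f \<delta>)\<close> vanishes.\<close>
    have one_in_image: "\<exists>y \<in> carrier R. f y = \<one>\<^bsub>R\<^esub>"
      if f: "f \<in> operators" "f \<noteq> \<zero>\<^bsub>?E\<^esub>" for f
    proof -
      have "f \<otimes>\<^bsub>?E\<^esub> \<delta> \<noteq> \<zero>\<^bsub>?E\<^esub>"
        using W.no_zero_divisors[of f \<delta>] f dalg.derivation_nonzero operators_delta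
        by (auto simp: carrier_D D_sel)
      moreover have "f \<otimes>\<^bsub>?E\<^esub> \<delta> \<in> operators" using f(1) operators_delta by (rule operators_mult)
      ultimately obtain b c where bc: "b \<in> operators" "c \<in> operators"
        and eq: "\<one>\<^bsub>?E\<^esub> = (f \<otimes>\<^bsub>?E\<^esub> \<delta>) \<otimes>\<^bsub>?E\<^esub> b \<oplus>\<^bsub>?E\<^esub> c \<otimes>\<^bsub>?E\<^esub> (f \<otimes>\<^bsub>?E\<^esub> \<delta>)"
        using W.weakly_fadelian[of "f \<otimes>\<^bsub>?E\<^esub> \<delta>"] by (auto simp: carrier_D D_sel)
      note cl = operators_closed[OF f(1)] operators_closed[OF bc(1)] operators_closed[OF bc(2)]
      have "\<one>\<^bsub>R\<^esub> = \<one>\<^bsub>?E\<^esub> \<one>\<^bsub>R\<^esub>" by (simp add: one_apply)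
      also have "\<dots> = f (\<delta> (b \<one>\<^bsub>R\<^esub>))"
        unfolding eq using cl by (simp add: applies closed delta_one op_zero)
      finally show ?thesis using cl by (intro bexI[of _ "\<delta> (b \<one>\<^bsub>R\<^esub>)"]) (simp_all add: closed)
    qed
    have unit: "x \<in> Units R" if x: "x \<in> carrier R" "x \<noteq> \<zero>\<^bsub>R\<^esub>" for x
    proof -
      have "\<iota> x \<one>\<^bsub>R\<^esub> \<noteq> \<zero>\<^bsub>?E\<^esub> \<one>\<^bsub>R\<^esub>" using x by (simp add: applies)
      then obtain y where y: "y \<in> carrier R" "\<iota> x y = \<one>\<^bsub>R\<^esub>"
        using one_in_image[OF operators_left_mult[OF x(1)]] by metis
      then have "x \<otimes>\<^bsub>R\<^esub> y = \<one>\<^bsub>R\<^esub>" by (simp add: left_mult_apply)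
      moreover from this have "y \<otimes>\<^bsub>R\<^esub> x = \<one>\<^bsub>R\<^esub>" using x y by (simp add: R.m_comm)
      ultimately show ?thesis using x y unfolding Units_def by blast
    qed
    have field: "field R"
    proof (rule R.cring_fieldI)
      have "\<zero>\<^bsub>R\<^esub> \<notin> Units R" using dalg.nontrivial by (auto simp: Units_def)
      then show "Units R = carrier R - {\<zero>\<^bsub>R\<^esub>}" using unit by (auto simp: Units_def)
    qed
    moreover have ?surj
    proof (intro ballI impI)
      fix f assume f: "f \<in> carrier ?D" "f \<noteq> \<zero>\<^bsub>?D\<^esub>"
      then have fo: "f \<in> operators" "f \<noteq> \<zero>\<^bsub>?E\<^esub>" by (simp_all add: carrier_D D_sel)
      note fc = operators_closed[OF fo(1)]
      have "\<exists>y \<in> carrier R. f y = r" if r: "r \<in> carrier R" for r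
      proof (cases "r = \<zero>\<^bsub>R\<^esub>")
        case True
        then show ?thesis using op_zero[OF fc] by (intro bexI[of _ "\<zero>\<^bsub>R\<^esub>"]) auto
      next
        case False
        define s where "s = inv\<^bsub>R\<^esub> r"
        have s: "s \<in> carrier R" "r \<otimes>\<^bsub>R\<^esub> s = \<one>\<^bsub>R\<^esub>"
          using unit[OF r False] by (simp_all add: s_def)
        have "\<iota> s \<noteq> \<zero>\<^bsub>?E\<^esub>"
        proof
          assume "\<iota> s = \<zero>\<^bsub>?E\<^esub>"
          then have "\<iota> s \<one>\<^bsub>R\<^esub> = \<zero>\<^bsub>R\<^esub>" by (simp add: zero_apply)
          then show False using s r dalg.nontrivial by (simp add: applies)
        qed
        then have "\<iota> s \<otimes>\<^bsub>?E\<^esub> f \<noteq> \<zero>\<^bsub>?E\<^esub>"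
          using W.no_zero_divisors[of "\<iota> s" f] fo operators_left_mult[OF s(1)]
          by (auto simp: carrier_D D_sel)
        then obtain y where y: "y \<in> carrier R" "(\<iota> s \<otimes>\<^bsub>?E\<^esub> f) y = \<one>\<^bsub>R\<^esub>"
          using one_in_image[OF operators_mult[OF operators_left_mult[OF s(1)] fo(1)]] by blast
        then have "s \<otimes>\<^bsub>R\<^esub> f y = \<one>\<^bsub>R\<^esub>" using s fc by (simp add: applies closed)
        then have "r \<otimes>\<^bsub>R\<^esub> (s \<otimes>\<^bsub>R\<^esub> f y) = r" using r by simp
        then have "f y = r" using s r y fc by (simp add: dalg.A.m_assoc[symmetric] closed)
        then show ?thesis using y by blast
      qed
      then show "f ` carrier R = carrier R" using fc op_closed by (auto simp: image_iff)
    qed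
    ultimately show "field R \<and> ?surj" by blast
  next
    assume asm: "field R \<and> ?surj"
    then interpret F: field R by blast
    interpret surjective_operator_ring ?E R \<delta>
    proof
      show "\<delta> \<noteq> \<zero>\<^bsub>?E\<^esub>" by (rule dalg.derivation_nonzero)
      show "\<exists>y \<in> carrier R. f y = x"
        if "f \<in> operators" "f \<noteq> \<zero>\<^bsub>?E\<^esub>" "x \<in> carrier R" for f x
      proof -
        have "x \<in> f ` carrier R" using asm that by (simp add: carrier_D D_sel)
        then show ?thesis by blast
      qed
    qed
    have "ring (?E\<lparr>carrier := operators\<rparr>)" using operators_subring by (rule E.subring_is_ring)
    moreover have "?E\<lparr>carrier := operators\<rparr> = ?D"
      using carrier_D by (simp add: differential_operators_def)
    ultimately interpret D: ring ?D by simp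
    have "\<one>\<^bsub>?E\<^esub> \<one>\<^bsub>R\<^esub> \<noteq> \<zero>\<^bsub>?E\<^esub> \<one>\<^bsub>R\<^esub>" using dalg.nontrivial by (simp add: one_apply zero_apply)
    then have "\<one>\<^bsub>?D\<^esub> \<noteq> \<zero>\<^bsub>?D\<^esub>" unfolding D_sel by metis
    then show ?wf
      by unfold_locales (use one_decomposition in \<open>auto simp: carrier_D D_sel\<close>)
  qed
qed

end
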